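(* Let $p$ be a prime with $p\equiv 13, 17, 19$ or $23\pmod{24}$. Then for all integers $n\geq 0$ and all $r\in \{1,\ldots, p-1\}$, $$\sum_{k=-\infty}^\infty (-1)^k a\left(5p^2n+5pr+\frac{25p^2-1}{24}-5k^2\right)\equiv 0\pmod{5}.$$ Here $k$ runs over all integers, and $a(m)=0$ for every integer $m<0$, so the sum is finite.
   Context: For a positive integer $m$ let $f_m := \prod_{j\geq 1}(1-q^{mj})$, where $|q|<1$ (equivalently, as a formal power series in $q$). The integer sequence $a(n)$, $n\ge 0$, is defined by the generating function $$\sum_{n\geq 0} a(n)q^n = \frac{f_2^2}{f_1^3},$$ and is extended by $a(m)=0$ for integers $m<0$. *)

theory Defs
  imports "HOL-Analysis.Analysis" "HOL-Number_Theory.Cong"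
begin

text \<open>
  The product $f_m$, as a formal power series over the integers. The factors are indexed from
  $0$, so \<open>Suc j\<close> plays the role of $j \geq 1$. The infinite product is the limit of the partial
  products in the usual (metric) topology on formal power series.
\<close>

definition euler_f :: "nat \<Rightarrow> int fps" where
  "euler_f m = (\<Prod>j. 1 - fps_X ^ (m * Suc j))"

text \<open>
  Over the integers there is no division operation on formal power series, so $1 / f_1^3$ is
  written with \<^term>\<open>fps_left_inverse\<close>; its second argument is the inverse of the
  constant coefficient of $f_1^3$, which is $1$. See \<open>a_gf_mult\<close> below.
\<close>

definition a_gf :: "int fps" where
  "a_gf = euler_f 2 ^ 2 * fps_left_inverse (euler_f 1 ^ 3) 1"

definition a_coeff :: "int \<Rightarrow> int" where
  "a_coeff m = (if m < 0 then 0 else fps_nth a_gf (nat m))"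

lemma euler_f_partial_stable:
  assumes m: "m \<ge> 1" and "n \<le> N"
  shows "fps_nth (\<Prod>j\<le>N. 1 - fps_X ^ (m * Suc j) :: int fps) n =
         fps_nth (\<Prod>j\<le>n. 1 - fps_X ^ (m * Suc j)) n"
  using \<open>n \<le> N\<close>
proof (induction N rule: dec_induct)
  case (step N)
  have "n < m * Suc (Suc N)"
  proof -
    have "1 * Suc (Suc N) \<le> m * Suc (Suc N)" using m by (intro mult_le_mono) auto
    with step.hyps show ?thesis by simp
  qed
  then show ?case
    using step by (simp add: right_diff_distrib fps_X_power_mult_right_nth del: mult_Suc_right)
qed auto

lemma euler_f_has_prod:
  assumes m: "m \<ge> 1"
  shows "(\<lambda>j. 1 - fps_X ^ (m * Suc j)) has_prod euler_f m"
    and "fps_nth (euler_f m) 0 = 1"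
proof -
  let ?F = "\<lambda>j. 1 - fps_X ^ (m * Suc j) :: int fps"
  define L where "L = Abs_fps (\<lambda>n. fps_nth (\<Prod>j\<le>n. ?F j) n)"
  have lim: "(\<lambda>N. \<Prod>j\<le>N. ?F j) \<longlonglongrightarrow> L"
  proof (rule tendsto_fpsI)
    fix n
    show "\<forall>\<^sub>F N in sequentially. fps_nth (\<Prod>j\<le>N. ?F j) n = fps_nth L n"
      using eventually_ge_at_top[of n]
      unfolding L_def fps_nth_Abs_fps
      by eventually_elim (rule euler_f_partial_stable[OF m])
  qed
  have L0: "fps_nth L 0 = 1"
    using m by (simp add: L_def fps_X_power_nth)
  then have "L \<noteq> 0" by auto
  with lim have hp: "?F has_prod L"
    by (simp add: has_prod_def raw_has_prod_def)
  have nz: "?F i \<noteq> 0" for i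
  proof -
    have "fps_nth (?F i) 0 = 1" using m by simp
    then show ?thesis by (metis fps_zero_nth zero_neq_one)
  qed
  have "q = L" if "?F has_prod q" for q
  proof -
    have "(\<lambda>N. \<Prod>j\<le>N. ?F j) \<longlonglongrightarrow> q"
      using that nz unfolding has_prod_def raw_has_prod_def by (simp del: mult_Suc_right)
    then show ?thesis using lim by (rule LIMSEQ_unique)
  qed
  with hp have "euler_f m = L"
    unfolding euler_f_def prodinf_def by (intro the_equality)
  with hp L0 show "?F has_prod euler_f m" "fps_nth (euler_f m) 0 = 1" by auto
qed

lemma a_gf_mult: "a_gf * euler_f 1 ^ 3 = euler_f 2 ^ 2"
proof -
  have "fps_nth (euler_f 1 ^ 3) 0 = 1"
    by (simp add: fps_nth_power_0 euler_f_has_prod(2))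
  then have "fps_left_inverse (euler_f 1 ^ 3) 1 * euler_f 1 ^ 3 = 1"
    by (intro fps_left_inverse) simp
  then show ?thesis
    unfolding a_gf_def by (simp add: mult.assoc)
qed

text \<open>
  The sum over all integers $k$ has only finitely many nonzero terms, so \<^term>\<open>infsum\<close> does not fall back on
  its default value.
\<close>

lemma a_coeff_sum:
  fixes N :: int
  defines "g \<equiv> \<lambda>k :: int. (- 1) ^ nat \<bar>k\<bar> * a_coeff (N - 5 * k\<^sup>2)"
  shows "finite {k. 5 * k\<^sup>2 \<le> N}" and "g summable_on UNIV"
    and "(\<Sum>\<^sub>\<infinity>k\<in>UNIV. g k) = (\<Sum>k | 5 * k\<^sup>2 \<le> N. g k)"
proof -
  have "\<bar>k\<bar> \<le> N" if "5 * k\<^sup>2 \<le> N" for k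
  proof -
    have "\<bar>k\<bar> * 1 \<le> \<bar>k\<bar> * \<bar>k\<bar>"
    proof (cases "k = 0")
      case False
      then show ?thesis by (intro mult_left_mono) linarith+
    qed simp
    then have "\<bar>k\<bar> \<le> k\<^sup>2" by (simp add: power2_eq_square)
    with that show ?thesis by linarith
  qed
  then have "{k. 5 * k\<^sup>2 \<le> N} \<subseteq> {-N..N}" by fastforce
  then show fin: "finite {k. 5 * k\<^sup>2 \<le> N}" by (rule finite_subset) simp
  have "(g has_sum sum g {k. 5 * k\<^sup>2 \<le> N}) {k. 5 * k\<^sup>2 \<le> N}"
    using fin by (rule has_sum_finite)
  then have "(g has_sum sum g {k. 5 * k\<^sup>2 \<le> N}) UNIV"
    by (rule has_sum_cong_neutral[THEN iffD1, rotated -1]) (auto simp: g_def a_coeff_def)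
  then show "g summable_on UNIV" "(\<Sum>\<^sub>\<infinity>k\<in>UNIV. g k) = (\<Sum>k | 5 * k\<^sup>2 \<le> N. g k)"
    by (auto simp: summable_on_def infsumI)
qed

end

theory Submission
  imports Defs "HOL-Computational_Algebra.Formal_Laurent_Series" "HOL-Library.Discrete_Functions"
begin

text \<open>
  Modulo $5$ one has $f_1^5 \equiv f_5$, and the alternating theta series
  $\varphi = \sum_k (-1)^k q^{k^2}$ equals $f_1^2/f_2$, so the generating function
  $\varphi(q^5) f_2^2/f_1^3$ of the sums in question is congruent to
  $f_1^2 f_2^2 \cdot \varphi(q^5)/f_5$. Here $2 f_1^2 f_2^2 = \varphi \cdot 2 f_2^3$ is a sum of
  $\pm y$ over the representations $4m + 1 = x^2 + y^2$ with $x$ even (weight two, complex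
  multiplication by $i$). Multiplying $x + iy$ by $2 \pm i$ shows that its coefficients satisfy
  $c(5m+1) \equiv -2 c(m)$. Hence the terms with exponent $5M + 1$ form the series
  $-2 f_1^3 f_2$, whose exponents $M$ satisfy $24 M + 5 = 3 Y^2 + 2 X^2$ by the identities of
  Jacobi and Euler. For the indices of the theorem $p$ divides $24 M + 5$ exactly once,
  whereas $-6$ is not a square modulo $p$, so there is no such representation.
\<close>

section \<open>Congruences modulo an element of a ring\<close>

text \<open>
  The constant \<^const>\<open>cong\<close> needs a Euclidean ring, which \<^typ>\<open>int fps\<close> is not. The modulus is
  $5$ in the arithmetic part, and a power of \<^const>\<open>fps_X\<close> where limits of finite identities are taken.
\<close>

definition dcong :: "'a::comm_ring_1 \<Rightarrow> 'a \<Rightarrow> 'a \<Rightarrow> bool" where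
  "dcong d a b \<longleftrightarrow> d dvd a - b"

lemma dcong_refl [simp]: "dcong d a a"
  by (simp add: dcong_def)

lemma dcong_sym: "dcong d a b \<Longrightarrow> dcong d b a"
  unfolding dcong_def by (metis dvd_minus_iff minus_diff_eq)

lemma dcong_trans [trans]: "dcong d a b \<Longrightarrow> dcong d b c \<Longrightarrow> dcong d a c"
  unfolding dcong_def using dvd_add[of d "a - b" "b - c"] by simp

lemma dcong_add: "dcong d a b \<Longrightarrow> dcong d a' b' \<Longrightarrow> dcong d (a + a') (b + b')"
  unfolding dcong_def by (metis add_diff_add dvd_add)

lemma dcong_mult: "dcong d a b \<Longrightarrow> dcong d a' b' \<Longrightarrow> dcong d (a * a') (b * b')"
proof -
  assume "dcong d a b" "dcong d a' b'"
  moreover have "a * a' - b * b' = (a - b) * a' + b * (a' - b')"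
    by (simp add: algebra_simps)
  ultimately show ?thesis
    unfolding dcong_def by (metis dvd_add dvd_mult dvd_mult2)
qed

lemma dcong_power: "dcong d a b \<Longrightarrow> dcong d (a ^ n) (b ^ n)"
  by (induction n) (auto intro: dcong_mult)

lemma dcong_sum: "(\<And>i. i \<in> I \<Longrightarrow> dcong d (f i) (g i)) \<Longrightarrow> dcong d (sum f I) (sum g I)"
  by (induction I rule: infinite_finite_induct) (auto intro: dcong_add)

lemma dcong_prod: "(\<And>i. i \<in> I \<Longrightarrow> dcong d (f i) (g i)) \<Longrightarrow> dcong d (prod f I) (prod g I)"
  by (induction I rule: infinite_finite_induct) (auto intro: dcong_mult)

section \<open>Gaussian binomials and the finite triple product\<close>

text \<open>Pascal's recursion serves as the definition of the Gaussian binomial, so no division by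
  factors \<open>1 - q ^ i\<close> is needed.\<close>

fun qbinom :: "'a::comm_ring_1 \<Rightarrow> nat \<Rightarrow> nat \<Rightarrow> 'a" where
  "qbinom q n 0 = 1"
| "qbinom q 0 (Suc k) = 0"
| "qbinom q (Suc n) (Suc k) = qbinom q n k + q ^ Suc k * qbinom q n (Suc k)"

lemma qbinom_eq_0: "n < k \<Longrightarrow> qbinom q n k = 0"
  by (induction q n k rule: qbinom.induct) auto

lemma zero_choose_two [simp]: "0 choose 2 = 0"
  by (simp add: numeral_2_eq_2)

lemma Suc_choose_two: "Suc j choose 2 = j + (j choose 2)"
  by (simp add: numeral_2_eq_2)

text \<open>Splitting off the factor with i = 0 turns x into x q in the rest, and the two resulting
  sums merge by Pascal's recursion. The homogeneous form lets y be a power of q, which avoids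
  negative powers in x.\<close>

lemma qbinom_theorem:
  fixes q x y :: "'a::comm_ring_1"
  shows "(\<Prod>i<n. y + x * q ^ i) = (\<Sum>j\<le>n. q ^ (j choose 2) * qbinom q n j * x ^ j * y ^ (n - j))"
proof (induction n arbitrary: x)
  case (Suc n)
  define S where "S = (\<lambda>j. q ^ (Suc j choose 2) * qbinom q n j * x ^ j * y ^ (Suc n - j))"
  have "(\<Prod>i<Suc n. y + x * q ^ i) = (y + x) * (\<Prod>i<n. y + (x * q) * q ^ i)"
    by (subst prod.lessThan_Suc_shift) (simp add: mult_ac)
  also have "\<dots> = (y + x) * (\<Sum>j\<le>n. q ^ (j choose 2) * qbinom q n j * (x * q) ^ j * y ^ (n - j))"
    by (simp only: Suc.IH)
  also have "\<dots> = (y + x) * (\<Sum>j\<le>n. q ^ (Suc j choose 2) * qbinom q n j * x ^ j * y ^ (n - j))"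
    by (simp add: Suc_choose_two power_mult_distrib power_add mult_ac)
  also have "\<dots> = (\<Sum>j\<le>n. S j) +
      (\<Sum>j\<le>n. q ^ (Suc j choose 2) * qbinom q n j * x ^ Suc j * y ^ (n - j))"
    by (simp add: distrib_right sum_distrib_left S_def Suc_diff_le mult_ac sum.distrib)
  also have "(\<Sum>j\<le>n. S j) = (\<Sum>j\<le>Suc n. S j)"
    by (simp add: S_def qbinom_eq_0)
  also have "\<dots> = S 0 + (\<Sum>j\<le>n. S (Suc j))"
    by (rule sum.atMost_Suc_shift)
  also have "S 0 + (\<Sum>j\<le>n. S (Suc j)) +
      (\<Sum>j\<le>n. q ^ (Suc j choose 2) * qbinom q n j * x ^ Suc j * y ^ (n - j)) =
      y ^ Suc n + (\<Sum>j\<le>n. q ^ (Suc j choose 2) * qbinom q (Suc n) (Suc j) * x ^ Suc j * y ^ (Suc n - Suc j))"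
  proof -
    have "S (Suc j) + q ^ (Suc j choose 2) * qbinom q n j * x ^ Suc j * y ^ (n - j) =
      q ^ (Suc j choose 2) * qbinom q (Suc n) (Suc j) * x ^ Suc j * y ^ (Suc n - Suc j)" for j
      by (simp add: S_def Suc_choose_two[of "Suc j"] power_add algebra_simps)
    then show ?thesis
      by (simp add: add.assoc flip: sum.distrib) (simp add: S_def numeral_2_eq_2)
  qed
  also have "\<dots> = (\<Sum>j\<le>Suc n. q ^ (j choose 2) * qbinom q (Suc n) j * x ^ j * y ^ (Suc n - j))"
    by (subst sum.atMost_Suc_shift) simp
  finally show ?case .
qed simp

lemma qbinom_mult_prod:
  fixes q :: "'a::comm_ring_1"
  shows "qbinom q n k * (\<Prod>i<k. 1 - q ^ Suc i) = (\<Prod>i<k. 1 - q ^ (n - i))"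
proof (induction q n k rule: qbinom.induct)
  case (2 q k)
  then show ?case by simp
next
  case (3 q n k)
  show ?case
  proof (cases "k \<le> n")
    case True
    have "qbinom q (Suc n) (Suc k) * (\<Prod>i<Suc k. 1 - q ^ Suc i) =
        (qbinom q n k * (\<Prod>i<k. 1 - q ^ Suc i)) * (1 - q ^ Suc k) +
        q ^ Suc k * (qbinom q n (Suc k) * (\<Prod>i<Suc k. 1 - q ^ Suc i))"
      by (simp add: algebra_simps)
    also have "\<dots> = (\<Prod>i<k. 1 - q ^ (n - i)) * (1 - q ^ Suc k) +
        q ^ Suc k * (\<Prod>i<Suc k. 1 - q ^ (n - i))"
      by (simp only: 3)
    also have "\<dots> = (\<Prod>i<k. 1 - q ^ (n - i)) * (1 - q ^ (Suc k + (n - k)))"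
      by (simp add: algebra_simps power_add)
    also have "\<dots> = (\<Prod>i<Suc k. 1 - q ^ (Suc n - i))"
      using True by (subst prod.lessThan_Suc_shift) (simp add: mult.commute)
    finally show ?thesis .
  next
    case False
    \<comment> \<open>The factor with i = \<open>Suc n\<close> is 1 - q^0 = 0.\<close>
    then have "(\<Prod>i<Suc k. 1 - q ^ (Suc n - i)) = 0"
      by (intro prod_zero bexI[of _ "Suc n"]) auto
    with False show ?thesis by (simp add: qbinom_eq_0)
  qed
qed simp

lemma prod_lessThan_add:
  fixes f :: "nat \<Rightarrow> 'a::comm_monoid_mult"
  shows "prod f {..<m + n} = prod f {..<m} * (\<Prod>i<n. f (m + i))"
  by (induction n) (simp_all add: mult.assoc)

text \<open>For $0 \le a \le b$ the exponent is nonnegative, so \<^const>\<open>nat\<close> does not truncate.\<close>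

definition jtp_exp :: "nat \<Rightarrow> nat \<Rightarrow> int \<Rightarrow> nat" where
  "jtp_exp b a k = nat (int b * (k * (k - 1) div 2) + int a * k)"

lemma int_choose_two: "int (j choose 2) * 2 = int j * (int j - 1)"
  by (induction j) (simp_all add: Suc_choose_two algebra_simps)

lemma jtp_exp_eq:
  assumes "a < b"
  shows "2 * int (jtp_exp b a k) = int b * (k * (k - 1)) + 2 * int a * k"
    and "\<bar>k\<bar> * min (int a) (int b - int a) \<le> int (jtp_exp b a k)"
proof -
  have d: "2 * (k * (k - 1) div 2) = k * (k - 1)"
    by simp
  let ?E = "int b * (k * (k - 1) div 2) + int a * k"
  have E: "2 * ?E = int b * (k * (k - 1)) + 2 * int a * k"
    using d by (metis (no_types, opaque_lifting) distrib_left mult.assoc mult.left_commute)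
  have *: "\<bar>k\<bar> * min (int a) (int b - int a) \<le> ?E"
  proof (cases "k \<ge> 1")
    case True
    then have "0 \<le> k * (k - 1) div 2" by (simp add: pos_imp_zdiv_nonneg_iff)
    then have "0 \<le> int b * (k * (k - 1) div 2)" by simp
    moreover have "k * min (int a) (int b - int a) \<le> k * int a"
      using True by (intro mult_left_mono) auto
    ultimately show ?thesis using True by (simp only: abs_of_nonneg mult.commute[of "int a" k])
  next
    case False
    \<comment> \<open>Write b k (k - 1) = b k (k + 1) - 2 b k; dropping the first term leaves 2 (-k)
      (b - a).\<close>
    have "0 \<le> k * (k + 1)" using False
      by (cases "k = 0") (auto intro: mult_nonpos_nonpos)
    then have "0 \<le> int b * (k * (k + 1))" by simp
    then have "2 * ?E \<ge> 2 * (-k) * (int b - int a)"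
      unfolding E by (simp add: algebra_simps)
    moreover have "- k * min (int a) (int b - int a) \<le> -k * (int b - int a)"
      using False by (intro mult_left_mono) auto
    ultimately show ?thesis using False by (simp add: mult.assoc)
  qed
  moreover have "0 \<le> \<bar>k\<bar> * min (int a) (int b - int a)" using assms by simp
  ultimately have "int (jtp_exp b a k) = ?E" by (simp add: jtp_exp_def)
  with E * show "2 * int (jtp_exp b a k) = int b * (k * (k - 1)) + 2 * int a * k"
    and "\<bar>k\<bar> * min (int a) (int b - int a) \<le> int (jtp_exp b a k)" by simp_all
qed

text \<open>With k = j - n fixed and n growing, the Gaussian binomial tends to the inverse of the
  product of all 1 - q^(b i), i >= 1, so the limit is Jacobi's triple product with its variable
  specialised to a power of q.\<close>

lemma finite_jacobi_triple_product:
  fixes q :: "'a::idom"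
  assumes ab: "0 < a" "a < b" and q: "q \<noteq> 0"
  shows "(\<Prod>i<n. 1 - q ^ (b * i + a)) * (\<Prod>i<n. 1 - q ^ (b * i + (b - a))) =
    (\<Sum>j\<le>2*n. (-1) ^ (n + j) * q ^ jtp_exp b a (int j - int n) * qbinom (q ^ b) (2 * n) j)"
proof (cases "n = 0")
  case False
  define y where "y = b * n - a"
  have y: "int y = int b * int n - int a"
  proof -
    have "a \<le> b * n" using ab False by (metis le_trans less_imp_le mult.right_neutral mult_le_mono2 not_gr0 One_nat_def Suc_leI)
    then show ?thesis by (simp add: y_def)
  qed
  \<comment> \<open>the $q$-binomial theorem with base $q^b$, $x = -1$ and $y = q^{bn - a}$; the factors with index $\ge n$ give
    \<open>?L\<close> and those with index $< n$ give \<open>?R\<close>, up to powers of $q$\<close>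
  let ?L = "\<Prod>i<n. 1 - q ^ (b * i + a)" and ?R = "\<Prod>i<n. 1 - q ^ (b * i + (b - a))"
  have split: "(\<Prod>i<2*n. q ^ y + (-1) * (q ^ b) ^ i) =
    (\<Prod>i<n. q ^ y + (-1) * (q ^ b) ^ i) * (\<Prod>i<n. q ^ y + (-1) * (q ^ b) ^ (n + i))"
    unfolding mult_2 by (rule prod_lessThan_add)
  have upper: "(\<Prod>i<n. q ^ y + (-1) * (q ^ b) ^ (n + i)) = q ^ (y * n) * ?L"
  proof -
    have "q ^ y + (-1) * (q ^ b) ^ (n + i) = q ^ y * (1 - q ^ (b * i + a))" for i
    proof -
      have "b * (n + i) = y + (b * i + a)"
        using y by (simp add: algebra_simps flip: of_nat_eq_iff[where ?'a = int])
      then show ?thesis by (simp add: algebra_simps flip: power_mult power_add)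
    qed
    then show ?thesis by (simp add: prod.distrib power_mult)
  qed
  have lower: "(\<Prod>i<n. q ^ y + (-1) * (q ^ b) ^ i) = (-1) ^ n * q ^ (b * (n choose 2)) * ?R"
  proof -
    have "q ^ y + (-1) * (q ^ b) ^ i = (- 1) * q ^ (b * i) * (1 - q ^ (b * (n - Suc i) + (b - a)))"
      if "i < n" for i
    proof -
      obtain d where d: "n = Suc i + d"
        using less_imp_Suc_add[OF \<open>i < n\<close>] by auto
      have "y = b * i + (b * (n - Suc i) + (b - a))"
        using y ab by (simp add: d algebra_simps of_nat_diff flip: of_nat_eq_iff[where ?'a = int])
      then show ?thesis by (simp add: algebra_simps flip: power_mult power_add)
    qed
    then have "(\<Prod>i<n. q ^ y + (-1) * (q ^ b) ^ i) =
        (\<Prod>i<n. (- 1) * q ^ (b * i)) * (\<Prod>i<n. 1 - q ^ (b * (n - Suc i) + (b - a)))"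
      by (simp only: flip: prod.distrib) (intro prod.cong; simp)
    also have "(\<Prod>i<n. 1 - q ^ (b * (n - Suc i) + (b - a))) = ?R"
      by (rule prod.nat_diff_reindex[of "\<lambda>i. 1 - q ^ (b * i + (b - a))"])
    also have "(\<Prod>i<n. (- 1) * q ^ (b * i)) = (-1) ^ n * q ^ (b * (n choose 2))"
      by (induction n) (simp_all add: Suc_choose_two power_add algebra_simps)
    finally show ?thesis .
  qed
  \<comment> \<open>The lower and upper halves release b C(n,2) and y n into the exponent of q; what
    remains of the exponent of term j depends only on k = j - n.\<close>
  have ex: "b * (j choose 2) + y * (2 * n - j) =
      b * (n choose 2) + y * n + jtp_exp b a (int j - int n)" if "j \<le> 2 * n" for j
  proof -
    have "2 * int (b * (j choose 2) + y * (2 * n - j)) =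
        int b * (int j * (int j - 1)) + 2 * int y * (2 * int n - int j)"
      using that int_choose_two[of j] by (simp add: of_nat_diff)
    also have "\<dots> = int b * (int n * (int n - 1)) + 2 * int y * int n +
        (int b * ((int j - int n) * (int j - int n - 1)) + 2 * int a * (int j - int n))"
      unfolding y by (simp add: algebra_simps)
    also have "\<dots> = 2 * int (b * (n choose 2) + y * n + jtp_exp b a (int j - int n))"
      using int_choose_two[of n] jtp_exp_eq(1)[OF ab(2)] by simp
    finally show ?thesis by (simp only: mult_cancel_left of_nat_eq_iff) simp
  qed
  have "(-1) ^ n * q ^ (b * (n choose 2) + y * n) * (?L * ?R) =
    (\<Prod>i<2*n. q ^ y + (-1) * (q ^ b) ^ i)"
    unfolding split upper lower by (simp add: power_add mult_ac)
  also have "\<dots> = (\<Sum>j\<le>2*n. (q ^ b) ^ (j choose 2) * qbinom (q ^ b) (2 * n) j * (-1) ^ j * (q ^ y) ^ (2 * n - j))"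
    by (rule qbinom_theorem)
  also have "\<dots> = (\<Sum>j\<le>2*n. (-1) ^ n * q ^ (b * (n choose 2) + y * n) *
      ((-1) ^ (n + j) * q ^ jtp_exp b a (int j - int n) * qbinom (q ^ b) (2 * n) j))"
  proof (intro sum.cong refl)
    fix j assume "j \<in> {..2*n}"
    then have pow: "(q ^ b) ^ (j choose 2) * (q ^ y) ^ (2 * n - j) =
        q ^ (b * (n choose 2) + y * n) * q ^ jtp_exp b a (int j - int n)"
      using ex[of j] by (simp flip: power_mult power_add)
    have sgn: "(-1) ^ n * (-1) ^ (n + j) = ((-1) ^ j :: 'a)"
      by (simp add: power_add flip: mult.assoc power_mult_distrib)
    have "(q ^ b) ^ (j choose 2) * qbinom (q ^ b) (2 * n) j * (-1) ^ j * (q ^ y) ^ (2 * n - j) =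
        ((q ^ b) ^ (j choose 2) * (q ^ y) ^ (2 * n - j)) * (-1) ^ j * qbinom (q ^ b) (2 * n) j"
      by (simp only: mult_ac)
    also have "\<dots> = (q ^ (b * (n choose 2) + y * n) * q ^ jtp_exp b a (int j - int n)) *
        ((-1) ^ n * (-1) ^ (n + j)) * qbinom (q ^ b) (2 * n) j"
      by (simp only: pow sgn)
    also have "\<dots> = (-1) ^ n * q ^ (b * (n choose 2) + y * n) *
      ((-1) ^ (n + j) * q ^ jtp_exp b a (int j - int n) * qbinom (q ^ b) (2 * n) j)"
      by (simp only: mult_ac)
    finally show "(q ^ b) ^ (j choose 2) * qbinom (q ^ b) (2 * n) j * (-1) ^ j * (q ^ y) ^ (2 * n - j) =
      (-1) ^ n * q ^ (b * (n choose 2) + y * n) *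
      ((-1) ^ (n + j) * q ^ jtp_exp b a (int j - int n) * qbinom (q ^ b) (2 * n) j)" .
  qed
  also have "\<dots> = (-1) ^ n * q ^ (b * (n choose 2) + y * n) *
      (\<Sum>j\<le>2*n. (-1) ^ (n + j) * q ^ jtp_exp b a (int j - int n) * qbinom (q ^ b) (2 * n) j)"
    by (simp only: sum_distrib_left)
  finally show ?thesis using q by simp
qed (simp add: jtp_exp_def)

text \<open>Triangular numbers indexed by all integers: each value is taken twice, at k and at -1 -
  k, where (-1)^k (2k + 1) agrees. This is the source of the factor 2 in the identities for the
  cube.\<close>

definition tri :: "int \<Rightarrow> nat" where
  "tri k = nat (k * (k + 1) div 2)"

lemma tri_eq: "2 * int (tri k) = k * (k + 1)" and tri_ge: "\<bar>k\<bar> \<le> int (tri k) + 1"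
proof -
  have "0 \<le> k * (k + 1)"
    by (cases "k \<ge> 0") (auto intro: mult_nonpos_nonpos)
  then have "0 \<le> k * (k + 1) div 2"
    by (simp add: pos_imp_zdiv_nonneg_iff)
  then show eq: "2 * int (tri k) = k * (k + 1)"
    by (simp add: tri_def)
  \<comment> \<open>Expanded: |k|^2 - |k| >= 2|k| - 2, and 2 \<open>tri k\<close> is at least the
    left side. The slack 1 is attained at k = -1 and k = -2.\<close>
  have "0 \<le> (\<bar>k\<bar> - 1) * (\<bar>k\<bar> - 2)"
    by (cases "\<bar>k\<bar> \<ge> 2"; cases "\<bar>k\<bar> = 1"; cases "k = 0") (auto intro: mult_nonpos_nonpos)
  moreover have "\<bar>k\<bar> * \<bar>k\<bar> = k * k" by simp
  ultimately show "\<bar>k\<bar> \<le> int (tri k) + 1"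
    using eq by (simp add: algebra_simps)
qed

text \<open>Of the 2n + 1 factors of the q-binomial theorem, n lie on each side of the middle one;
  at z = 1 each side gives the product of the 1 - q^i up to sign and a power of q, hence the
  square.\<close>

lemma finite_jacobi_cube:
  fixes q :: "'a::{idom,ring_char_0}"
  assumes q: "q \<noteq> 0"
  shows "2 * (\<Prod>i<n. 1 - q ^ Suc i)\<^sup>2 =
    (\<Sum>j\<le>2*n+1. of_int ((-1) ^ (n + 1 + j) * (2 * (int j - int (n + 1)) + 1)) *
      q ^ tri (int j - int (n + 1)) * qbinom q (2 * n + 1) j)"
proof -
  define N where "N = 2 * n + 1"
  \<comment> \<open>This is the exponent of q in \<open>- (q ^ n) * poly W 1\<close>.\<close>
  define E where "E = n + n * n + (n choose 2)"
  define c where "c = (\<lambda>j. q ^ (j choose 2) * qbinom q N j * (-1) ^ j * (q ^ n) ^ (N - j))"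
  define f where "f = (\<lambda>i. [:q ^ n, - (q ^ i):])"
  define R where "R = (\<Sum>j\<le>N. monom (c j) j)"
  \<comment> \<open>the $q$-binomial theorem in $z$ has the factor $1 - z$ of index $n$; compare derivatives at $z = 1$\<close>
  define W where "W = prod f {..<n} * (\<Prod>i<n. f (Suc n + i))"
  let ?P = "\<Prod>i<n. 1 - q ^ Suc i"
  \<comment> \<open>Differentiation requires an identity of polynomials; it follows from equality at
    all points because an integral domain of characteristic 0 is infinite.\<close>
  have PR: "prod f {..<N} = R"
  proof -
    have "poly (prod f {..<N}) z = poly R z" for z
    proof -
      have "poly (prod f {..<N}) z = (\<Prod>i<N. q ^ n + (- z) * q ^ i)"
        by (simp add: f_def poly_prod mult.commute)
      also have "\<dots> = (\<Sum>j\<le>N. q ^ (j choose 2) * qbinom q N j * (- z) ^ j * (q ^ n) ^ (N - j))"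
        by (rule qbinom_theorem)
      also have "\<dots> = poly R z"
        unfolding R_def c_def poly_sum poly_monom
        by (intro sum.cong refl) (simp add: power_minus[of z] mult_ac)
      finally show ?thesis .
    qed
    then show ?thesis by (simp add: poly_eq_poly_eq_iff[symmetric] fun_eq_iff)
  qed
  have "prod f {..<N} = f n * W"
    unfolding N_def W_def mult_2 using prod_lessThan_add[of f "Suc n" n] by (simp add: mult_ac)
  then have R: "R = f n * W" by (simp add: PR)
  have "poly R 1 = 0" by (simp add: R f_def)
  then have sum0: "(\<Sum>j\<le>N. c j) = 0" by (simp add: R_def poly_sum poly_monom)
  \<comment> \<open>Since \<open>f n\<close> vanishes at 1, the product rule leaves only the
    derivative of \<open>f n\<close> times \<open>W\<close>.\<close>
  have "poly (pderiv R) 1 = - (q ^ n) * poly W 1"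
    unfolding R pderiv_mult poly_add poly_mult by (simp add: f_def pderiv_pCons)
  then have sum1: "(\<Sum>j\<le>N. of_nat j * c j) = - (q ^ n) * poly W 1"
    by (simp add: R_def higher_pderiv_sum[of 1, simplified] pderiv_monom poly_sum poly_monom)
  have W: "poly W 1 = (-1) ^ n * q ^ (n * n + (n choose 2)) * ?P\<^sup>2"
  proof -
    have "(\<Prod>i<n. q ^ n - q ^ i) = (\<Prod>i<n. - (q ^ i) * (1 - q ^ (Suc (n - Suc i))))"
      by (intro prod.cong refl) (auto simp: algebra_simps simp flip: power_add power_Suc)
    also have "\<dots> = (\<Prod>i<n. - (q ^ i)) * ?P"
      unfolding prod.distrib by (simp only: prod.nat_diff_reindex[of "\<lambda>i. 1 - q ^ Suc i"])
    also have "(\<Prod>i<n. - (q ^ i)) = (-1) ^ n * q ^ (n choose 2)"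
      by (induction n) (simp_all add: Suc_choose_two power_add algebra_simps)
    finally have 1: "(\<Prod>i<n. q ^ n - q ^ i) = (-1) ^ n * q ^ (n choose 2) * ?P" .
    have "(\<Prod>i<n. q ^ n - q ^ (Suc n + i)) = (\<Prod>i<n. q ^ n * (1 - q ^ Suc i))"
      by (intro prod.cong refl) (simp add: algebra_simps power_add)
    then have 2: "(\<Prod>i<n. q ^ n - q ^ (Suc n + i)) = q ^ (n * n) * ?P"
      by (simp add: prod.distrib power_mult)
    have "poly W 1 = (\<Prod>i<n. q ^ n - q ^ i) * (\<Prod>i<n. q ^ n - q ^ (Suc n + i))"
      by (simp add: W_def f_def poly_prod)
    also have "\<dots> = (-1) ^ n * q ^ (n * n + (n choose 2)) * ?P\<^sup>2"
      unfolding 1 2 by (simp add: power_add power2_eq_square mult_ac)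
    finally show ?thesis .
  qed
  have cj: "c j = (-1) ^ j * q ^ E * q ^ tri (int j - int (n + 1)) * qbinom q N j" if "j \<le> N" for j
  proof -
    have nj: "int (N - j) = 2 * int n + 1 - int j"
      using that by (simp add: N_def of_nat_diff)
    have "2 * int ((j choose 2) + n * (N - j)) = int j * (int j - 1) + 2 * int n * (2 * int n + 1 - int j)"
      by (simp only: of_nat_add of_nat_mult nj flip: int_choose_two) (simp add: algebra_simps)
    also have "\<dots> = 2 * int n + 2 * int n * int n + int n * (int n - 1) +
        (int j - int (n + 1)) * (int j - int (n + 1) + 1)"
      by (simp add: algebra_simps)
    also have "\<dots> = 2 * int (E + tri (int j - int (n + 1)))"
      using int_choose_two[of n] tri_eq[of "int j - int (n + 1)"] unfolding E_def by simp
    finally have "(j choose 2) + n * (N - j) = E + tri (int j - int (n + 1))"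
      by (simp only: mult_cancel_left of_nat_eq_iff) simp
    then have pow: "q ^ (j choose 2) * (q ^ n) ^ (N - j) = q ^ E * q ^ tri (int j - int (n + 1))"
      by (simp flip: power_mult power_add)
    have "c j = (-1) ^ j * (q ^ (j choose 2) * (q ^ n) ^ (N - j)) * qbinom q N j"
      unfolding c_def by (simp only: mult_ac)
    then show ?thesis by (simp only: pow mult.assoc)
  qed
  have K: "(-1) ^ Suc n * q ^ E \<noteq> 0" using q by simp
  have "(-1) ^ Suc n * q ^ E * (2 * ?P\<^sup>2) = 2 * (- (q ^ n) * poly W 1)"
    unfolding W E_def by (simp add: power_add mult_ac)
  \<comment> \<open>Subtracting N times the vanishing sum centres the weight: 2j - N = 2k + 1 for k
    = j - (n + 1).\<close>
  also have "\<dots> = 2 * (\<Sum>j\<le>N. of_nat j * c j) - of_nat N * (\<Sum>j\<le>N. c j)"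
    by (simp add: sum0 sum1)
  also have "\<dots> = (\<Sum>j\<le>N. of_int (2 * (int j - int (n + 1)) + 1) * c j)"
    unfolding sum_distrib_left sum_subtractf[symmetric]
    by (intro sum.cong refl) (simp add: N_def algebra_simps)
  also have "\<dots> = (\<Sum>j\<le>N. (-1) ^ Suc n * q ^ E * (of_int ((-1) ^ (n + 1 + j) * (2 * (int j - int (n + 1)) + 1)) *
      q ^ tri (int j - int (n + 1)) * qbinom q N j))"
  proof (intro sum.cong refl)
    fix j assume "j \<in> {..N}"
    then have cj: "c j = (-1) ^ j * q ^ E * q ^ tri (int j - int (n + 1)) * qbinom q N j"
      by (intro cj) simp
    have sgn: "(-1) ^ Suc n * (-1) ^ (n + 1 + j) = ((-1) ^ j :: 'a)"
      by (simp add: power_add flip: mult.assoc power_mult_distrib)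
    have "of_int (2 * (int j - int (n + 1)) + 1) * c j =
       ((-1) ^ Suc n * (-1) ^ (n + 1 + j)) * of_int (2 * (int j - int (n + 1)) + 1) *
        q ^ E * q ^ tri (int j - int (n + 1)) * qbinom q N j"
      unfolding sgn cj by (simp only: mult_ac)
    also have "\<dots> = (-1) ^ Suc n * q ^ E * (of_int ((-1) ^ (n + 1 + j) * (2 * (int j - int (n + 1)) + 1)) *
      q ^ tri (int j - int (n + 1)) * qbinom q N j)"
      by (simp only: of_int_mult of_int_power of_int_minus of_int_1 mult_ac)
    finally show "of_int (2 * (int j - int (n + 1)) + 1) * c j =
      (-1) ^ Suc n * q ^ E * (of_int ((-1) ^ (n + 1 + j) * (2 * (int j - int (n + 1)) + 1)) *
      q ^ tri (int j - int (n + 1)) * qbinom q N j)" .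
  qed
  finally show ?thesis
    unfolding sum_distrib_left[symmetric] mult_left_cancel[OF K] N_def .
qed

section \<open>Limits of power series as congruences modulo powers of X\<close>

lemma fps_X_power_dvd_iff:
  fixes F :: "'a::comm_ring_1 fps"
  shows "fps_X ^ M dvd F \<longleftrightarrow> (\<forall>i<M. fps_nth F i = 0)"
proof
  assume "fps_X ^ M dvd F"
  then show "\<forall>i<M. fps_nth F i = 0" by (auto simp: fps_X_power_mult_nth elim!: dvdE)
next
  assume *: "\<forall>i<M. fps_nth F i = 0"
  have "F = fps_X ^ M * Abs_fps (\<lambda>i. fps_nth F (i + M))"
    using * by (auto simp: fps_eq_iff fps_X_power_mult_nth)
  then show "fps_X ^ M dvd F" by (rule dvdI)
qed

lemma fps_eqI_dcong:
  fixes F G :: "'a::comm_ring_1 fps"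
  assumes "\<And>M. dcong (fps_X ^ M) F G"
  shows "F = G"
proof (rule fps_ext)
  fix i
  have "fps_nth (F - G) i = 0"
    using assms[of "Suc i"] by (simp only: dcong_def fps_X_power_dvd_iff)
  then show "fps_nth F i = fps_nth G i" by simp
qed

lemma euler_f_dcong_prod:
  assumes "b \<ge> 1" "n \<ge> M"
  shows "dcong (fps_X ^ M) (euler_f b) (\<Prod>i<n. 1 - (fps_X ^ b) ^ Suc i)"
\<comment> \<open>For M = 0 also n = 0 is possible, and then the range up to n - 1 used below would
  not be empty.\<close>
proof (cases "M = 0")
  case True
  then show ?thesis by (simp add: dcong_def)
next
  case False
  let ?F = "\<lambda>n. \<Prod>j\<le>n. 1 - fps_X ^ (b * Suc j) :: int fps"
  have "?F \<longlonglongrightarrow> euler_f b"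
    by (rule has_prod_imp_tendsto[OF euler_f_has_prod(1)[OF assms(1)]])
  then have ev: "\<forall>\<^sub>F N in sequentially. fps_nth (?F N) i = fps_nth (euler_f b) i" for i
    by (auto simp: tendsto_fps_iff)
  have "fps_nth (euler_f b) i = fps_nth (?F (n - 1)) i" if "i < M" for i
  proof -
    from ev[of i] obtain N where N: "\<And>n. n \<ge> N \<Longrightarrow> fps_nth (?F n) i = fps_nth (euler_f b) i"
      by (auto simp: eventually_sequentially)
    have "fps_nth (euler_f b) i = fps_nth (?F (max N i)) i" using N[of "max N i"] by simp
    also have "\<dots> = fps_nth (?F i) i" by (rule euler_f_partial_stable[OF assms(1)]) simp
    also have "\<dots> = fps_nth (?F (n - 1)) i"
      by (rule euler_f_partial_stable[OF assms(1), symmetric]) (use that assms in simp)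
    finally show ?thesis .
  qed
  moreover have "?F (n - 1) = (\<Prod>i<n. 1 - (fps_X ^ b) ^ Suc i)"
    using False assms by (intro prod.cong) (auto simp: power_mult[symmetric] simp del: power_Suc)
  ultimately show ?thesis by (simp only: dcong_def fps_X_power_dvd_iff) simp
qed

text \<open>Modulo X^M the first j factors of \<open>euler_f b\<close> suffice and cancel the
  denominator of the Gaussian binomial. The numerator factors 1 - X^(b (N - i)) are 1 modulo X^M,
  because N - i >= M.\<close>

lemma qbinom_euler_f_dcong_1:
  assumes "b \<ge> 1" "j \<ge> M" "N \<ge> j + M"
  shows "dcong (fps_X ^ M) (qbinom (fps_X ^ b) N j * euler_f b) 1"
proof -
  have "dcong (fps_X ^ M) (qbinom (fps_X ^ b) N j * euler_f b)
      (qbinom (fps_X ^ b) N j * (\<Prod>i<j. 1 - (fps_X ^ b) ^ Suc i))"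
    by (intro dcong_mult dcong_refl euler_f_dcong_prod assms)
  also have "qbinom (fps_X ^ b) N j * (\<Prod>i<j. 1 - (fps_X ^ b) ^ Suc i) =
      (\<Prod>i<j. 1 - (fps_X ^ b) ^ (N - i) :: int fps)"
    by (rule qbinom_mult_prod)
  also have "dcong (fps_X ^ M) \<dots> (\<Prod>i<j. 1)"
  proof (intro dcong_prod)
    fix i assume "i \<in> {..<j}"
    then have "M \<le> 1 * (N - i)" using assms by simp
    also have "\<dots> \<le> b * (N - i)" using assms(1) by (rule mult_le_mono1)
    finally have "fps_X ^ M dvd (fps_X ^ b) ^ (N - i)"
      by (simp add: le_imp_power_dvd flip: power_mult)
    then show "dcong (fps_X ^ M) (1 - (fps_X ^ b) ^ (N - i)) 1"
      by (simp add: dcong_def)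
  qed
  finally show ?thesis by simp
qed

section \<open>Theta series\<close>

text \<open>Only meaningful if \<open>e\<close> has finite fibres, since a sum over an infinite set is $0$.\<close>

definition theta :: "('k \<Rightarrow> int) \<Rightarrow> ('k \<Rightarrow> nat) \<Rightarrow> int fps" where
  "theta s e = Abs_fps (\<lambda>m. \<Sum>k | e k = m. s k)"

lemma theta_nth: "fps_nth (theta s e) m = (\<Sum>k | e k = m. s k)"
  by (simp add: theta_def)

lemma theta_dcong_sum:
  assumes "finite S" and "\<And>k. e k < M \<Longrightarrow> k \<in> S"
  shows "dcong (fps_X ^ M) (theta s e) (\<Sum>k\<in>S. fps_const (s k) * fps_X ^ e k)"
  unfolding dcong_def fps_X_power_dvd_iff
proof safe
  fix i assume i: "i < M"
  have "(\<Sum>k | e k = i. s k) = (\<Sum>k\<in>S. if i = e k then s k else 0)"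
    using assms i by (intro sum.mono_neutral_cong_left) auto
  then show "fps_nth (theta s e - (\<Sum>k\<in>S. fps_const (s k) * fps_X ^ e k)) i = 0"
    by (simp add: theta_nth fps_sum_nth fps_X_power_nth mult_delta_right cong: if_cong)
qed

text \<open>The common passage to the limit, with c the index of the central term. If j or N - j is
  below M, then k = j - c is so large that X^M divides the term; otherwise the Gaussian binomial
  times \<open>euler_f b\<close> is 1 modulo X^M.\<close>

lemma qbinom_sum_dcong_theta:
  fixes s :: "int \<Rightarrow> int"
  assumes b: "b \<ge> 1" and e: "\<And>k. \<bar>k\<bar> \<le> int (e k) + 1" and c: "c \<ge> 2 * M + 1" "N \<ge> c + 2 * M + 1"
  shows "dcong (fps_X ^ M) ((\<Sum>j\<le>N. fps_const (s (int j - int c)) * fps_X ^ e (int j - int c) *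
            qbinom (fps_X ^ b) N j) * euler_f b) (theta s e)"
proof -
  let ?k = "\<lambda>j. int j - int c"
  have "dcong (fps_X ^ M) (theta s e) (\<Sum>k\<in>?k ` {..N}. fps_const (s k) * fps_X ^ e k)"
  proof (rule theta_dcong_sum)
    fix k assume "e k < M"
    then have "\<bar>k\<bar> \<le> int M" using e[of k] by linarith
    then have "k = ?k (nat (k + int c))" "nat (k + int c) \<le> N" using c by linarith+
    then show "k \<in> ?k ` {..N}" by blast
  qed simp
  also have "(\<Sum>k\<in>?k ` {..N}. fps_const (s k) * fps_X ^ e k) =
      (\<Sum>j\<le>N. fps_const (s (?k j)) * fps_X ^ e (?k j))"
    by (subst sum.reindex) (auto intro: inj_onI)
  also have "dcong (fps_X ^ M) \<dots> (\<Sum>j\<le>N. fps_const (s (?k j)) * fps_X ^ e (?k j) *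
            (qbinom (fps_X ^ b) N j * euler_f b))"
  proof (intro dcong_sum)
    fix j assume "j \<in> {..N}"
    show "dcong (fps_X ^ M) (fps_const (s (?k j)) * fps_X ^ e (?k j))
        (fps_const (s (?k j)) * fps_X ^ e (?k j) * (qbinom (fps_X ^ b) N j * euler_f b))"
    proof (cases "j \<ge> M \<and> N \<ge> j + M")
      case True
      then have "dcong (fps_X ^ M) (fps_const (s (?k j)) * fps_X ^ e (?k j) * (qbinom (fps_X ^ b) N j * euler_f b))
         (fps_const (s (?k j)) * fps_X ^ e (?k j) * 1)"
        by (intro dcong_mult dcong_refl qbinom_euler_f_dcong_1 b) auto
      then show ?thesis by (simp add: dcong_sym)
    next
      case False
      then have "M \<le> e (?k j)" using e[of "?k j"] c by linarith
      then have "fps_X ^ M dvd (fps_X ^ e (?k j) :: int fps)" by (rule le_imp_power_dvd)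
      then show ?thesis by (auto simp: dcong_def intro!: dvd_diff)
    qed
  qed
  finally show ?thesis
    unfolding sum_distrib_right mult.assoc by (rule dcong_sym)
qed

text \<open>Needed to apply \<open>finite_jacobi_cube\<close> to integer power series, with q a
  power of X.\<close>

instance fps :: (ring_char_0) ring_char_0 ..

section \<open>Product formulas of Jacobi, Gauss and Euler for theta series\<close>

lemma minus_one_power_nat_abs: "(-1 :: int) ^ nat \<bar>k\<bar> = (if even k then 1 else -1)"
  by (simp add: uminus_power_if even_nat_iff)

lemma minus_one_power_nat_abs_diff: "(-1 :: int) ^ nat \<bar>int j - int n\<bar> = (-1) ^ (n + j)"
  unfolding minus_one_power_nat_abs by (auto simp: uminus_power_if)

text \<open>The products over the residue classes a and -a modulo b stay finite, so that they can be
  regrouped into a truncated \<open>euler_f\<close> before the limit is taken.\<close>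

lemma jacobi_triple_product_dcong:
  assumes ab: "0 < a" "a < b" and n: "n \<ge> 2 * M + 1"
  shows "dcong (fps_X ^ M) (euler_f b * ((\<Prod>i<n. 1 - fps_X ^ (b * i + a)) *
      (\<Prod>i<n. 1 - fps_X ^ (b * i + (b - a))))) (theta (\<lambda>k. (-1) ^ nat \<bar>k\<bar>) (jtp_exp b a))"
proof -
  have e: "\<bar>k\<bar> \<le> int (jtp_exp b a k) + 1" for k
  proof -
    have "\<bar>k\<bar> * 1 \<le> \<bar>k\<bar> * min (int a) (int b - int a)"
      using ab by (intro mult_left_mono) auto
    with jtp_exp_eq(2)[OF ab(2), of k] show ?thesis by linarith
  qed
  have "(\<Prod>i<n. 1 - fps_X ^ (b * i + a)) * (\<Prod>i<n. 1 - fps_X ^ (b * i + (b - a))) =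
    (\<Sum>j\<le>2*n. (-1) ^ (n + j) * fps_X ^ jtp_exp b a (int j - int n) * qbinom (fps_X ^ b) (2 * n) j :: int fps)"
    by (rule finite_jacobi_triple_product[OF ab]) simp
  also have "\<dots> = (\<Sum>j\<le>2*n. fps_const ((-1) ^ nat \<bar>int j - int n\<bar>) *
      fps_X ^ jtp_exp b a (int j - int n) * qbinom (fps_X ^ b) (2 * n) j)"
    unfolding minus_one_power_nat_abs_diff
    by (simp add: fps_const_power[symmetric] fps_const_neg[symmetric] del: fps_const_power fps_const_neg)
  finally show ?thesis
    using qbinom_sum_dcong_theta[of b "jtp_exp b a" M n "2 * n" "\<lambda>k. (-1) ^ nat \<bar>k\<bar>"] ab n e
    by (simp add: mult.commute)
qed

lemma prod_split_parity:
  fixes f :: "nat \<Rightarrow> 'a::comm_monoid_mult"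
  shows "(\<Prod>i<n. f (2 * Suc i)) * (\<Prod>i<n. f (2 * i + 1)) = (\<Prod>i<2*n. f (Suc i))"
  by (induction n) (simp_all add: mult_ac)

lemma prod_split_mod_3:
  fixes f :: "nat \<Rightarrow> 'a::comm_monoid_mult"
  shows "(\<Prod>i<n. f (3 * Suc i)) * ((\<Prod>i<n. f (3 * i + 1)) * (\<Prod>i<n. f (3 * i + 2))) = (\<Prod>i<3*n. f (Suc i))"
  by (induction n) (simp_all add: mult_ac numeral_3_eq_3)

text \<open>Here the exponent is k^2, and both residue classes are the odd numbers. With D their
  product, the theta series is f_2 D^2 and f_2 D = f_1; multiplying by f_2 avoids a
  quotient.\<close>

lemma gauss_square_theta:
  "theta (\<lambda>k. (-1) ^ nat \<bar>k\<bar>) (jtp_exp 2 1) * euler_f 2 = euler_f 1 ^ 2" (is "?T * _ = _")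
proof (rule fps_eqI_dcong)
  fix M :: nat
  define n where "n = 2 * M + 1"
  define D where "D = (\<Prod>i<n. 1 - fps_X ^ (2 * i + 1) :: int fps)"
  have split: "(\<Prod>i<n. 1 - (fps_X ^ 2) ^ Suc i) * D = (\<Prod>i<2*n. 1 - (fps_X ^ 1) ^ Suc i)"
    unfolding D_def using prod_split_parity[of "\<lambda>j. 1 - fps_X ^ j" n]
    by (simp only: power_mult[symmetric] mult_1)
  have "dcong (fps_X ^ M) (euler_f 2 * D) ((\<Prod>i<n. 1 - (fps_X ^ 2) ^ Suc i) * D)"
    by (intro dcong_mult dcong_refl euler_f_dcong_prod) (auto simp: n_def)
  also have "dcong (fps_X ^ M) \<dots> (euler_f 1)"
    unfolding split by (rule dcong_sym, rule euler_f_dcong_prod) (auto simp: n_def)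
  finally have fD: "dcong (fps_X ^ M) (euler_f 2 * D) (euler_f 1)" .
  have "dcong (fps_X ^ M) ?T (euler_f 2 * (D * D))"
    by (rule dcong_sym, use jacobi_triple_product_dcong[of 1 2 M n] in \<open>simp add: n_def D_def\<close>)
  then have "dcong (fps_X ^ M) (?T * euler_f 2) (euler_f 2 * (D * D) * euler_f 2)"
    by (intro dcong_mult dcong_refl)
  also have "euler_f 2 * (D * D) * euler_f 2 = (euler_f 2 * D) ^ 2"
    by (simp add: power2_eq_square mult_ac)
  also have "dcong (fps_X ^ M) \<dots> (euler_f 1 ^ 2)"
    by (rule dcong_power[OF fD])
  finally show "dcong (fps_X ^ M) (?T * euler_f 2) (euler_f 1 ^ 2)" .
qed

text \<open>Euler's pentagonal number theorem in q^2, with exponent 3k^2 - k: the residues 0, 2 and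
  4 modulo 6 together make up the even numbers.\<close>

lemma pentagonal_theta:
  "theta (\<lambda>k. (-1) ^ nat \<bar>k\<bar>) (jtp_exp 6 2) = euler_f 2"
proof (rule fps_eqI_dcong)
  fix M :: nat
  define n where "n = 2 * M + 1"
  define D where "D = (\<Prod>i<n. 1 - fps_X ^ (6 * i + 2) :: int fps) * (\<Prod>i<n. 1 - fps_X ^ (6 * i + 4))"
  have split: "(\<Prod>i<n. 1 - (fps_X ^ 6) ^ Suc i) * D = (\<Prod>i<3*n. 1 - (fps_X ^ 2) ^ Suc i)"
  proof -
    have "6 * Suc i = 2 * (3 * Suc i)" "6 * i + 2 = 2 * (3 * i + 1)" "6 * i + 4 = 2 * (3 * i + 2)" for i
      by simp_all
    then show ?thesis
      using prod_split_mod_3[of "\<lambda>j. 1 - fps_X ^ (2 * j)" n] by (simp only: D_def power_mult[symmetric])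
  qed
  have "dcong (fps_X ^ M) (theta (\<lambda>k. (-1) ^ nat \<bar>k\<bar>) (jtp_exp 6 2)) (euler_f 6 * D)"
    by (rule dcong_sym, use jacobi_triple_product_dcong[of 2 6 M n] in \<open>simp add: n_def D_def\<close>)
  also have "dcong (fps_X ^ M) \<dots> ((\<Prod>i<n. 1 - (fps_X ^ 6) ^ Suc i) * D)"
    by (intro dcong_mult dcong_refl euler_f_dcong_prod) (auto simp: n_def)
  also have "dcong (fps_X ^ M) \<dots> (euler_f 2)"
    unfolding split by (rule dcong_sym, rule euler_f_dcong_prod) (auto simp: n_def)
  finally show "dcong (fps_X ^ M) (theta (\<lambda>k. (-1) ^ nat \<bar>k\<bar>) (jtp_exp 6 2)) (euler_f 2)" .
qed

text \<open>The finite identity supplies two of the three factors; the third is the one that cancels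
  the Gaussian binomials in the limit.\<close>

lemma jacobi_cube_theta:
  assumes b: "b \<ge> 1"
  shows "theta (\<lambda>k. (-1) ^ nat \<bar>k\<bar> * (2 * k + 1)) (\<lambda>k. b * tri k) = 2 * euler_f b ^ 3"
    (is "theta ?s ?e = _")
proof (rule fps_eqI_dcong)
  fix M :: nat
  define n where "n = 2 * M + 1"
  let ?P = "\<Prod>i<n. 1 - (fps_X ^ b) ^ Suc i :: int fps"
  have e: "\<bar>k\<bar> \<le> int (b * tri k) + 1" for k
  proof -
    have "1 * tri k \<le> b * tri k" using b by (rule mult_le_mono1)
    then show ?thesis using tri_ge[of k] by linarith
  qed
  have "2 * ?P\<^sup>2 = (\<Sum>j\<le>2*n+1. of_int ((-1) ^ (n + 1 + j) * (2 * (int j - int (n + 1)) + 1)) *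
      (fps_X ^ b) ^ tri (int j - int (n + 1)) * qbinom (fps_X ^ b) (2 * n + 1) j)"
    by (rule finite_jacobi_cube) simp
  also have "\<dots> = (\<Sum>j\<le>2*n+1. fps_const (?s (int j - int (n + 1))) *
      fps_X ^ ?e (int j - int (n + 1)) * qbinom (fps_X ^ b) (2 * n + 1) j)"
    unfolding minus_one_power_nat_abs_diff by (simp only: fps_of_int[symmetric] power_mult of_int_eq_id id_apply)
  finally have eq: "2 * ?P\<^sup>2 = \<dots>" .
  have "dcong (fps_X ^ M) (theta ?s ?e) (2 * ?P\<^sup>2 * euler_f b)"
    unfolding eq by (rule dcong_sym, rule qbinom_sum_dcong_theta[OF b e, where s = ?s]) (simp_all add: n_def)
  also have "dcong (fps_X ^ M) \<dots> (2 * euler_f b ^ 2 * euler_f b)"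
    by (intro dcong_mult dcong_refl dcong_power dcong_sym[OF euler_f_dcong_prod]) (use b n_def in auto)
  also have "2 * euler_f b ^ 2 * euler_f b = 2 * euler_f b ^ 3"
    by (simp add: power2_eq_square power3_eq_cube mult_ac)
  finally show "dcong (fps_X ^ M) (theta ?s ?e) (2 * euler_f b ^ 3)" .
qed

section \<open>Products and substitutions of theta series\<close>

lemma dcong_fps_X_power_nth:
  "dcong (fps_X ^ M) F G \<Longrightarrow> i < M \<Longrightarrow> fps_nth F i = fps_nth G i"
  by (auto simp: dcong_def fps_X_power_dvd_iff)

lemma theta_mult_nth:
  assumes "finite {k. e k \<le> m}"
  shows "fps_nth (theta s e * F) m = (\<Sum>k | e k \<le> m. s k * fps_nth F (m - e k))"
proof -
  have "dcong (fps_X ^ Suc m) (theta s e * F) ((\<Sum>k | e k \<le> m. fps_const (s k) * fps_X ^ e k) * F)"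
    using assms by (intro dcong_mult dcong_refl theta_dcong_sum) auto
  then have "fps_nth (theta s e * F) m = fps_nth ((\<Sum>k | e k \<le> m. fps_const (s k) * fps_X ^ e k) * F) m"
    by (rule dcong_fps_X_power_nth) simp
  also have "\<dots> = (\<Sum>k | e k \<le> m. s k * fps_nth F (m - e k))"
    unfolding sum_distrib_right fps_sum_nth mult.assoc
    by (intro sum.cong) (auto simp: fps_X_power_mult_nth)
  finally show ?thesis .
qed

lemma theta_mult:
  assumes e: "\<And>m. finite {k. e k \<le> m}" and g: "\<And>m. finite {l. g l \<le> m}"
  shows "theta s e * theta t g = theta (\<lambda>(k, l). s k * t l) (\<lambda>(k, l). e k + g l)"
proof (rule fps_ext)
  fix m
  have fin: "finite {l. g l = i}" for i
    by (rule finite_subset[OF _ g[of i]]) auto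
  have "fps_nth (theta s e * theta t g) m = (\<Sum>k | e k \<le> m. \<Sum>l | g l = m - e k. s k * t l)"
    by (simp add: theta_mult_nth[OF e] theta_nth sum_distrib_left)
  also have "\<dots> = (\<Sum>(k, l)\<in>(SIGMA k:{k. e k \<le> m}. {l. g l = m - e k}). s k * t l)"
    by (rule sum.Sigma) (auto simp: e fin)
  also have "(SIGMA k:{k. e k \<le> m}. {l. g l = m - e k}) = {(k, l). e k + g l = m}"
    by auto
  finally show "fps_nth (theta s e * theta t g) m =
      fps_nth (theta (\<lambda>(k, l). s k * t l) (\<lambda>(k, l). e k + g l)) m"
    by (simp add: theta_nth case_prod_unfold)
qed

lemma theta_compose_X_power:
  "d > 0 \<Longrightarrow> theta s e oo fps_X ^ d = theta s (\<lambda>k. d * e k)"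
  by (rule fps_ext) (auto simp: fps_nth_compose_X_power theta_nth intro!: sum.cong sum.neutral)

lemma finite_le_of_abs_le:
  fixes e :: "int \<Rightarrow> nat"
  assumes "\<And>k. \<bar>k\<bar> \<le> int (e k) + c"
  shows "finite {k. e k \<le> m}"
proof (rule finite_subset)
  show "{k. e k \<le> m} \<subseteq> {- (int m + c)..int m + c}"
  proof safe
    fix k assume "e k \<le> m"
    with assms[of k] show "k \<in> {- (int m + c)..int m + c}" by auto
  qed
qed simp

section \<open>Coefficientwise congruences and the Frobenius map modulo 5\<close>

lemma fps_const_dvd_iff:
  fixes F :: "'a::comm_ring_1 fps"
  shows "fps_const c dvd F \<longleftrightarrow> (\<forall>i. c dvd fps_nth F i)"
proof
  assume "\<forall>i. c dvd fps_nth F i"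
  then obtain g where "\<And>i. fps_nth F i = c * g i" unfolding dvd_def by metis
  then have "F = fps_const c * Abs_fps g" by (simp add: fps_eq_iff)
  then show "fps_const c dvd F" by (rule dvdI)
qed (auto elim!: dvdE)

lemma dcong_numeral_fps_iff:
  fixes F G :: "'a::comm_ring_1 fps"
  shows "dcong (numeral w) F G \<longleftrightarrow> (\<forall>i. dcong (numeral w) (fps_nth F i) (fps_nth G i))"
  unfolding dcong_def numeral_fps_const fps_const_dvd_iff by simp

text \<open>The congruence (1 - t)^5 = 1 - t^5 modulo 5 is applied to each factor; coefficient i
  sees only the first i + 1 factors.\<close>

lemma euler_f_1_power_5_dcong: "dcong 5 (euler_f 5) (euler_f 1 ^ 5)"
  unfolding dcong_numeral_fps_iff
proof
  fix i
  let ?P = "\<lambda>b. \<Prod>j<Suc i. 1 - (fps_X ^ b) ^ Suc j :: int fps"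
  have frob: "dcong 5 (1 - t ^ 5) ((1 - t) ^ 5)" for t :: "int fps"
  proof -
    have "1 - t ^ 5 - (1 - t) ^ 5 = 5 * (t - 2 * t ^ 2 + 2 * t ^ 3 - t ^ 4)"
      by algebra
    then show ?thesis unfolding dcong_def by (rule dvdI)
  qed
  have "dcong 5 (?P 5) (\<Prod>j<Suc i. (1 - (fps_X ^ 1) ^ Suc j) ^ 5)"
  proof (rule dcong_prod)
    fix j
    show "dcong 5 (1 - (fps_X ^ 5) ^ Suc j) ((1 - (fps_X ^ 1) ^ Suc j) ^ 5 :: int fps)"
      using frob[of "fps_X ^ Suc j"] by (simp only: power_one_right power_mult[symmetric] mult.commute)
  qed
  then have "dcong 5 (?P 5) (?P 1 ^ 5)" by (simp only: prod_power_distrib)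
  then have "dcong 5 (fps_nth (?P 5) i) (fps_nth (?P 1 ^ 5) i)"
    unfolding dcong_numeral_fps_iff ..
  moreover have "fps_nth (euler_f 5) i = fps_nth (?P 5) i"
    by (rule dcong_fps_X_power_nth[OF euler_f_dcong_prod[where M = "Suc i"]]) auto
  moreover have "fps_nth (euler_f 1 ^ 5) i = fps_nth (?P 1 ^ 5) i"
    by (rule dcong_fps_X_power_nth[OF dcong_power[OF euler_f_dcong_prod[where M = "Suc i"]]]) auto
  ultimately show "dcong 5 (fps_nth (euler_f 5) i) (fps_nth (euler_f 1 ^ 5) i)" by simp
qed

lemma euler_f_compose:
  assumes "d \<ge> 1"
  shows "euler_f 1 oo fps_X ^ d = euler_f d"
proof (rule fps_ext)
  fix i
  let ?P = "\<lambda>b. \<Prod>j<Suc i. 1 - (fps_X ^ b) ^ Suc j :: int fps"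
  have P: "fps_nth (euler_f b) j = fps_nth (?P b) j" if "b \<ge> 1" "j \<le> i" for b j
    by (rule dcong_fps_X_power_nth[OF euler_f_dcong_prod[where M = "Suc i"]]) (use that in auto)
  have "?P 1 oo fps_X ^ d = ?P d"
    using assms by (simp add: fps_compose_prod_distrib fps_compose_sub_distrib fps_X_power_compose fps_compose_mult_distrib del: power_Suc)
  then have "fps_nth (?P 1 oo fps_X ^ d) i = fps_nth (?P d) i" by simp
  \<comment> \<open>When d divides i, the composition takes its coefficient from index
    \<open>i div d\<close>, so the truncation chosen for i covers both sides.\<close>
  moreover have "i div d \<le> i" by simp
  ultimately show "fps_nth (euler_f 1 oo fps_X ^ d) i = fps_nth (euler_f d) i"
    using P[of d i] P[of 1 "i div d"] assms by (simp only: fps_nth_compose_X_power)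
qed

section \<open>Primes modulo which $-6$ is not a square\<close>

lemma square_mod_24: "(x::int)\<^sup>2 mod 24 \<in> {0, 1, 4, 9, 12, 16}"
proof -
  have "x mod 24 \<in> set [0..23]" by simp
  moreover have "\<forall>r\<in>set [0..23]. (r::int)\<^sup>2 mod 24 \<in> {0, 1, 4, 9, 12, 16}"
    by code_simp
  ultimately have "(x mod 24)\<^sup>2 mod 24 \<in> {0, 1, 4, 9, 12, 16}" by blast
  then show ?thesis by (simp only: power_mod)
qed

text \<open>These are the two reduced forms of discriminant -24. The four excluded classes are the
  classes prime to 24 that neither form represents.\<close>

lemma forms_mod_24:
  fixes x y :: int
  shows "(x\<^sup>2 + 6 * y\<^sup>2) mod 24 \<notin> {13, 17, 19, 23}" and "(2 * x\<^sup>2 + 3 * y\<^sup>2) mod 24 \<notin> {13, 17, 19, 23}"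
proof -
  have "(x\<^sup>2 + 6 * y\<^sup>2) mod 24 = (x\<^sup>2 mod 24 + 6 * (y\<^sup>2 mod 24)) mod 24"
    "(2 * x\<^sup>2 + 3 * y\<^sup>2) mod 24 = (2 * (x\<^sup>2 mod 24) + 3 * (y\<^sup>2 mod 24)) mod 24"
    by (intro mod_add_cong mod_mult_cong refl; simp)+
  moreover have "\<forall>a\<in>{0, 1, 4, 9, 12, 16}. \<forall>b\<in>{0, 1, 4, 9, 12, 16 :: int}.
      (a + 6 * b) mod 24 \<notin> {13, 17, 19, 23} \<and> (2 * a + 3 * b) mod 24 \<notin> {13, 17, 19, 23}"
    by code_simp
  ultimately show "(x\<^sup>2 + 6 * y\<^sup>2) mod 24 \<notin> {13, 17, 19, 23}" "(2 * x\<^sup>2 + 3 * y\<^sup>2) mod 24 \<notin> {13, 17, 19, 23}"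
    using square_mod_24[of x] square_mod_24[of y] by metis+
qed

text \<open>Pigeonhole: with s the integer part of the square root of p there are (s + 1)^2 > p
  pairs (a, b), so two of them agree in a - u b modulo p, and their difference is (x, y). The bounds
  are strict because a prime is not a square.\<close>

lemma thue:
  fixes p u :: int
  assumes "prime p"
  obtains x y where "p dvd x - u * y" "x \<noteq> 0 \<or> y \<noteq> 0" "x\<^sup>2 < p" "y\<^sup>2 < p"
proof -
  define s where "s = floor_sqrt (nat p)"
  have p: "p > 1" using assms by (simp add: prime_gt_1_int)
  have "s\<^sup>2 \<le> nat p" "nat p < (Suc s)\<^sup>2"
    unfolding s_def by (rule floor_sqrt_power2_le, rule Suc_floor_sqrt_power2_gt)
  then have s: "int s ^ 2 \<le> p" "p < (int s + 1) ^ 2"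
    using p by (auto simp: le_nat_iff nat_less_iff add.commute)
  have "int s ^ 2 \<noteq> p"
    using assms by (metis prime_power_iff numeral_eq_one_iff semiring_norm(83) one_eq_numeral_iff)
  with s have s2: "int s ^ 2 < p" by simp
  define f where "f = (\<lambda>(a, b). (a - u * b) mod p)"
  have "\<not> inj_on f ({0..int s} \<times> {0..int s})"
  proof
    assume inj: "inj_on f ({0..int s} \<times> {0..int s})"
    have "card ({0..int s} \<times> {0..int s}) \<le> card {0..<p}"
      by (rule card_inj_on_le[OF inj]) (use p in \<open>auto simp: f_def\<close>)
    moreover have "nat (int s + 1) = s + 1" by simp
    ultimately have "(s + 1) * (s + 1) \<le> nat p" by simp
    then have "(int s + 1) ^ 2 \<le> p"
      using p by (simp add: power2_eq_square le_nat_iff algebra_simps)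
    with s show False by simp
  qed
  then obtain a b a' b' where ab: "a \<in> {0..int s}" "b \<in> {0..int s}" "a' \<in> {0..int s}" "b' \<in> {0..int s}"
    "(a, b) \<noteq> (a', b')" "f (a, b) = f (a', b')"
    unfolding inj_on_def by blast
  have small: "(v - w)\<^sup>2 < p" if "v \<in> {0..int s}" "w \<in> {0..int s}" for v w
  proof -
    have "\<bar>v - w\<bar> \<le> \<bar>int s\<bar>" using that by auto
    then have "(v - w)\<^sup>2 \<le> int s ^ 2" by (simp only: abs_le_square_iff)
    with s2 show ?thesis by simp
  qed
  from ab(6) have "p dvd (a - u * b) - (a' - u * b')"
    by (simp add: f_def mod_eq_dvd_iff)
  then have "p dvd (a - a') - u * (b - b')" by (simp add: algebra_simps)
  with ab small show ?thesis by (intro that[of "a - a'" "b - b'"]) auto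
qed

text \<open>If u^2 = -6 modulo p, a small solution of x = u y gives x^2 + 6 y^2 = k p with 0 < k <
  7. Removing the factors 2 and 3 of k represents p, or 5p when k = 5, by a form of discriminant
  -24, against \<open>forms_mod_24\<close>.\<close>

lemma not_dvd_square_plus_6:
  fixes p u :: int
  assumes "prime p" "p mod 24 \<in> {13, 17, 19, 23}"
  shows "\<not> p dvd u\<^sup>2 + 6"
proof
  assume u: "p dvd u\<^sup>2 + 6"
  obtain x y where xy: "p dvd x - u * y" "x \<noteq> 0 \<or> y \<noteq> 0" "x\<^sup>2 < p" "y\<^sup>2 < p"
    using thue[OF assms(1)] by metis
  have "x\<^sup>2 + 6 * y\<^sup>2 = (x - u * y) * (x + u * y) + (u\<^sup>2 + 6) * y\<^sup>2"
    by (simp add: algebra_simps power2_eq_square)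
  then have "p dvd x\<^sup>2 + 6 * y\<^sup>2" using u xy(1) by simp
  then obtain k where k: "x\<^sup>2 + 6 * y\<^sup>2 = p * k" by (auto elim: dvdE)
  have p: "p > 0" using assms(1) by (simp add: prime_gt_0_int)
  have "0 < x\<^sup>2 + 6 * y\<^sup>2" using xy(2)
    by (metis add_nonneg_pos add_pos_nonneg mult_pos_pos zero_le_power2 zero_less_numeral zero_less_power2 mult_nonneg_nonneg zero_le_numeral)
  then have "0 < k" using p by (simp add: k zero_less_mult_iff)
  moreover have "p * k < p * 7" using xy(3,4) by (simp flip: k)
  then have "k < 7" using p by simp
  ultimately consider "k = 1" | "k = 2" | "k = 3" | "k = 4" | "k = 5" | "k = 6" by linarith
  then show False
  proof cases
    case 1
    then show ?thesis using k forms_mod_24(1)[of x y] assms(2) by simp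
  next
    case 2
    then have "x\<^sup>2 = 2 * (p - 3 * y\<^sup>2)" using k by simp
    then have "even (x\<^sup>2)" by simp
    then obtain z where z: "x = 2 * z" by auto
    then have "2 * z\<^sup>2 + 3 * y\<^sup>2 = p" using k 2 by (simp add: power_mult_distrib)
    then show ?thesis using forms_mod_24(2)[of z y] assms(2) by simp
  next
    case 3
    then have "x\<^sup>2 = 3 * (p - 2 * y\<^sup>2)" using k by simp
    then have "3 dvd x\<^sup>2" by simp
    then have "3 dvd x" by (rule prime_dvd_power[rotated]) simp
    then obtain z where z: "x = 3 * z" by (auto elim: dvdE)
    then have "2 * y\<^sup>2 + 3 * z\<^sup>2 = p" using k 3 by (simp add: power_mult_distrib)
    then show ?thesis using forms_mod_24(2)[of y z] assms(2) by simp
  next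
    case 4
    then have "x\<^sup>2 = 2 * (2 * p - 3 * y\<^sup>2)" using k by simp
    then have "even (x\<^sup>2)" by simp
    then obtain z where z: "x = 2 * z" by auto
    then have e: "2 * z\<^sup>2 + 3 * y\<^sup>2 = 2 * p" using k 4 by (simp add: power_mult_distrib)
    then have "3 * y\<^sup>2 = 2 * (p - z\<^sup>2)" by simp
    then have "even (3 * y\<^sup>2)" by simp
    then obtain w where w: "y = 2 * w" by auto
    then have "z\<^sup>2 + 6 * w\<^sup>2 = p" using e by (simp add: power_mult_distrib)
    then show ?thesis using forms_mod_24(1)[of z w] assms(2) by simp
  next
    case 5
    \<comment> \<open>Multiplication by 5 permutes the four classes: it exchanges 13 with 17 and 19
      with 23.\<close>
    have "(p * 5) mod 24 = ((p mod 24) * 5) mod 24" by (simp add: mod_simps)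
    then have "(p * 5) mod 24 \<in> {13, 17, 19, 23}" using assms(2) by auto
    then show ?thesis using forms_mod_24(1)[of x y] k 5 by simp
  next
    case 6
    then have "x\<^sup>2 = 2 * (3 * (p - y\<^sup>2))" using k by simp
    then have "2 dvd x\<^sup>2" "3 dvd x\<^sup>2" by simp_all
    then have "2 dvd x" "3 dvd x" by (auto intro: prime_dvd_power[of 3])
    then have "6 dvd x" by presburger
    then obtain z where z: "x = 6 * z" by (auto elim: dvdE)
    then have "y\<^sup>2 + 6 * z\<^sup>2 = p" using k 6 by (simp add: power_mult_distrib)
    then show ?thesis using forms_mod_24(1)[of y z] assms(2) by simp
  qed
qed

text \<open>If p did not divide Y, then with a inverse to Y modulo p the number 2 X a would be a
  square root of -6.\<close>

lemma dvd_form_imp_dvd: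
  fixes p X Y :: int
  assumes p: "prime p" "p mod 24 \<in> {13, 17, 19, 23}" and "p dvd 2 * X\<^sup>2 + 3 * Y\<^sup>2"
  shows "p dvd X" "p dvd Y"
proof -
  have p2: "\<not> p dvd 2"
  proof
    assume "p dvd 2"
    then have "p \<le> 2" by (simp add: zdvd_imp_le)
    with prime_ge_2_int[OF p(1)] have "p = 2" by simp
    with p(2) show False by simp
  qed
  show Y: "p dvd Y"
  proof (rule ccontr)
    assume "\<not> p dvd Y"
    then have "coprime Y p" using prime_imp_coprime[OF p(1)] by (metis coprime_commute)
    then obtain a where a: "[Y * a = 1] (mod p)" using cong_solve_coprime_int by metis
    have "p dvd Y * a - 1" using a by (simp add: cong_iff_dvd_diff)
    moreover have "(2 * X * a)\<^sup>2 + 6 =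
        2 * a\<^sup>2 * (2 * X\<^sup>2 + 3 * Y\<^sup>2) - 6 * (Y * a + 1) * (Y * a - 1)"
      by (simp add: algebra_simps power2_eq_square)
    ultimately have "p dvd (2 * X * a)\<^sup>2 + 6"
      using assms(3) by (metis dvd_diff dvd_mult)
    with not_dvd_square_plus_6[OF p] show False by blast
  qed
  then have "p dvd 3 * Y\<^sup>2" by (simp add: power2_eq_square)
  with assms(3) have "p dvd 2 * X\<^sup>2" by (simp add: dvd_add_left_iff)
  then show "p dvd X" using p(1) p2 by (metis prime_dvd_mult_iff prime_dvd_power)
qed

section \<open>Exponents congruent to 1 modulo 5\<close>

definition section5 :: "'a fps \<Rightarrow> 'a fps" where
  "section5 F = Abs_fps (\<lambda>M. fps_nth F (5 * M + 1))"

lemma section5_nth [simp]: "fps_nth (section5 F) M = fps_nth F (5 * M + 1)"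
  by (simp add: section5_def)

text \<open>A series in X^5 has only exponents divisible by 5, so it leaves the class of 1 modulo 5
  fixed and can be pulled out.\<close>

lemma section5_compose_mult:
  fixes F G :: "'a::comm_ring_1 fps"
  shows "section5 ((G oo fps_X ^ 5) * F) = G * section5 F"
proof (rule fps_ext)
  fix M
  have "fps_nth ((G oo fps_X ^ 5) * F) (5 * M + 1) =
      (\<Sum>i\<le>5 * M + 1. fps_nth (G oo fps_X ^ 5) i * fps_nth F (5 * M + 1 - i))"
    by (simp add: fps_mult_nth atLeast0AtMost)
  also have "\<dots> = (\<Sum>i\<in>(\<lambda>j. 5 * j) ` {..M}. fps_nth (G oo fps_X ^ 5) i * fps_nth F (5 * M + 1 - i))"
  proof (rule sum.mono_neutral_right)
    show "\<forall>i\<in>{..5 * M + 1} - (\<lambda>j. 5 * j) ` {..M}. fps_nth (G oo fps_X ^ 5) i * fps_nth F (5 * M + 1 - i) = 0"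
    proof
      fix i assume i: "i \<in> {..5 * M + 1} - (\<lambda>j. 5 * j) ` {..M}"
      have "\<not> 5 dvd i"
      proof
        assume "5 dvd i"
        then obtain j where "i = 5 * j" by (rule dvdE)
        with i show False by auto
      qed
      then show "fps_nth (G oo fps_X ^ 5) i * fps_nth F (5 * M + 1 - i) = 0"
        by (simp add: fps_nth_compose_X_power)
    qed
  qed auto
  also have "\<dots> = (\<Sum>j\<le>M. fps_nth G j * fps_nth F (5 * (M - j) + 1))"
  proof (subst sum.reindex)
    show "(\<Sum>j\<le>M. ((\<lambda>i. fps_nth (G oo fps_X ^ 5) i * fps_nth F (5 * M + 1 - i)) \<circ> (\<lambda>j. 5 * j)) j) =
        (\<Sum>j\<le>M. fps_nth G j * fps_nth F (5 * (M - j) + 1))"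
    proof (intro sum.cong refl)
      fix j assume "j \<in> {..M}"
      then have "5 * M + 1 - 5 * j = 5 * (M - j) + 1" by auto
      then show "((\<lambda>i. fps_nth (G oo fps_X ^ 5) i * fps_nth F (5 * M + 1 - i)) \<circ> (\<lambda>j. 5 * j)) j =
          fps_nth G j * fps_nth F (5 * (M - j) + 1)"
        by (simp add: fps_nth_compose_X_power)
    qed
  qed (auto intro: inj_onI)
  finally show "fps_nth (section5 ((G oo fps_X ^ 5) * F)) M = fps_nth (G * section5 F) M"
    by (simp add: fps_mult_nth atLeast0AtMost)
qed

lemma section5_dcong: "dcong (numeral w) F G \<Longrightarrow> dcong (numeral w) (section5 F) (section5 G)"
  unfolding dcong_numeral_fps_iff by simp

lemma section5_mult_numeral: "section5 (numeral w * F :: int fps) = numeral w * section5 F"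
  by (simp add: fps_eq_iff numeral_fps_const)

text \<open>The representations $(2k)^2 + (2l+1)^2 = 4m + 1$.\<close>

definition two_squares :: "int \<Rightarrow> (int \<times> int) set" where
  "two_squares m = {(k, l). k * k + l * (l + 1) = m}"

text \<open>The product of the coefficients of the Gauss series at k and of the Jacobi cube series
  at l; up to sign, the odd coordinate of 2k + (2l + 1) i.\<close>

definition hecke_weight :: "int \<times> int \<Rightarrow> int" where
  "hecke_weight = (\<lambda>(k, l). (-1) ^ nat \<bar>k\<bar> * ((-1) ^ nat \<bar>l\<bar> * (2 * l + 1)))"

lemma finite_two_squares: "finite (two_squares m)"
proof (rule finite_subset)
  show "two_squares m \<subseteq> {-m..m} \<times> {-m-1..m+1}"
  proof
    fix z assume "z \<in> two_squares m"
    then obtain k l where z: "z = (k, l)" "k * k + l * (l + 1) = m" by (auto simp: two_squares_def)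
    have "int (tri l) \<ge> \<bar>l\<bar> - 1" "2 * int (tri l) = l * (l + 1)" using tri_ge[of l] tri_eq[of l] by auto
    moreover have "\<bar>k\<bar> \<le> k * k"
    proof (cases "k = 0")
      case False
      then have "\<bar>k\<bar> * 1 \<le> \<bar>k\<bar> * \<bar>k\<bar>" by (intro mult_left_mono) auto
      then show ?thesis by simp
    qed simp
    ultimately show "z \<in> {-m..m} \<times> {-m-1..m+1}" using z by auto
  qed
qed simp

text \<open>Since 4 (5m + 1) + 1 = 5 (4m + 1), every representation counted in the first sum arises
  from one in the second by multiplication with an element of norm 5. Those that arise from both
  elements have weight divisible by 5, and the weights of the two images of z add up to -2 times
  that of z.\<close>

lemma hecke_weight_sum_dcong:
  "5 dvd (\<Sum>z\<in>two_squares (5 * m + 1). hecke_weight z) + 2 * (\<Sum>z\<in>two_squares m. hecke_weight z)"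
proof -
  \<comment> \<open>multiplication of $2k - (2l+1)i$ by $1 + 2i$ and by $-1 + 2i$, in the coordinates $(k, l)$\<close>
  define f where "f = (\<lambda>(k :: int, l :: int). (k + 2 * l + 1, 2 * k - l - 1))"
  define g where "g = (\<lambda>(k :: int, l :: int). (2 * l + 1 - k, 2 * k + l))"
  let ?R = "two_squares m" and ?S = "two_squares (5 * m + 1)"
  have inj: "inj_on f ?R" "inj_on g ?R"
    by (auto simp: inj_on_def f_def g_def)
  have f_iff: "f z \<in> ?S \<longleftrightarrow> z \<in> ?R" and g_iff: "g z \<in> ?S \<longleftrightarrow> z \<in> ?R" for z
  proof -
    obtain k l where z: "z = (k, l)" by (cases z)
    have "(k + 2 * l + 1) * (k + 2 * l + 1) + (2 * k - l - 1) * (2 * k - l - 1 + 1) = 5 * (k * k + l * (l + 1)) + 1"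
      "(2 * l + 1 - k) * (2 * l + 1 - k) + (2 * k + l) * (2 * k + l + 1) = 5 * (k * k + l * (l + 1)) + 1"
      by algebra+
    then show "f z \<in> ?S \<longleftrightarrow> z \<in> ?R" "g z \<in> ?S \<longleftrightarrow> z \<in> ?R"
      unfolding z f_def g_def two_squares_def case_prod_conv mem_Collect_eq
      by (simp_all only:) (simp_all del: distrib_left_numeral)
  qed
  have fS: "f ` ?R = {(k, l) \<in> ?S. 5 dvd k + 2 * l + 1}"
  proof (intro set_eqI iffI)
    fix z assume "z \<in> {(k, l) \<in> ?S. 5 dvd k + 2 * l + 1}"
    then obtain k l t where z: "z = (k, l)" "z \<in> ?S" "k + 2 * l + 1 = 5 * t" by (auto elim: dvdE)
    \<comment> \<open>The preimage comes from inverting the linear map \<open>f\<close>; the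
      quotient t is its first coordinate.\<close>
    then have "z = f (t, 2 * t - l - 1)" by (simp add: f_def)
    with z(2) f_iff show "z \<in> f ` ?R" by blast
  next
    fix z assume "z \<in> f ` ?R"
    then obtain k l where "z = f (k, l)" "z \<in> ?S" using f_iff by auto
    moreover have "(k + 2 * l + 1) + 2 * (2 * k - l - 1) + 1 = 5 * k" by simp
    ultimately show "z \<in> {(k, l) \<in> ?S. 5 dvd k + 2 * l + 1}" by (simp add: f_def)
  qed
  have gS: "g ` ?R = {(k, l) \<in> ?S. 5 dvd k - 2 * l - 1}"
  proof (intro set_eqI iffI)
    fix z assume "z \<in> {(k, l) \<in> ?S. 5 dvd k - 2 * l - 1}"
    then obtain k l t where z: "z = (k, l)" "z \<in> ?S" "k - 2 * l - 1 = 5 * t" by (auto elim: dvdE)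
    then have "z = g (- t, l + 2 * t)" by (simp add: g_def)
    with z(2) g_iff show "z \<in> g ` ?R" by blast
  next
    fix z assume "z \<in> g ` ?R"
    then obtain k l where "z = g (k, l)" "z \<in> ?S" using g_iff by auto
    moreover have "(2 * l + 1 - k) - 2 * (2 * k + l) - 1 = 5 * (- k)" by simp
    ultimately show "z \<in> {(k, l) \<in> ?S. 5 dvd k - 2 * l - 1}" by (simp add: g_def)
  qed
  have cover: "f ` ?R \<union> g ` ?R = ?S"
  proof -
    have "5 dvd k + 2 * l + 1 \<or> 5 dvd k - 2 * l - 1" if "(k, l) \<in> ?S" for k l
    proof -
      \<comment> \<open>Modulo 5 one has 4 = -1, so the norm (2k)^2 + (2l + 1)^2 splits into linear
        factors up to sign.\<close>
      have "(k + 2 * l + 1) * (k - 2 * l - 1) = 5 * (m - l * (l + 1))"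
        using that by (simp add: two_squares_def algebra_simps)
      then have "5 dvd (k + 2 * l + 1) * (k - 2 * l - 1)" by simp
      moreover have "prime (5 :: int)" by simp
      ultimately show ?thesis by (simp only: prime_dvd_mult_iff)
    qed
    then show ?thesis unfolding fS gS by auto
  qed
  have both: "5 dvd sum hecke_weight (f ` ?R \<inter> g ` ?R)"
  proof (rule dvd_sum)
    fix z assume "z \<in> f ` ?R \<inter> g ` ?R"
    then obtain k l where z: "z = (k, l)" "5 dvd k + 2 * l + 1" "5 dvd k - 2 * l - 1"
      unfolding fS gS by auto
    then have "5 dvd 2 * l + 1" by presburger
    then show "5 dvd hecke_weight z" by (simp add: z hecke_weight_def)
  qed
  \<comment> \<open>The sign of \<open>f z\<close> is that of z and the sign of \<open>g z\<close>
    is the opposite, so k cancels: (4k - 2l - 1) - (4k + 2l + 1) = -2 (2l + 1).\<close>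
  have "hecke_weight (f z) + hecke_weight (g z) = - 2 * hecke_weight z" for z
    by (cases z) (auto simp: f_def g_def hecke_weight_def minus_one_power_nat_abs)
  then have "sum hecke_weight (f ` ?R) + sum hecke_weight (g ` ?R) = - 2 * sum hecke_weight ?R"
    by (simp only: sum.reindex[OF inj(1)] sum.reindex[OF inj(2)] o_def sum_distrib_left flip: sum.distrib)
  moreover have "sum hecke_weight ?S + sum hecke_weight (f ` ?R \<inter> g ` ?R) =
      sum hecke_weight (f ` ?R) + sum hecke_weight (g ` ?R)"
    unfolding cover[symmetric] by (rule sum.union_inter) (simp_all add: finite_two_squares)
  ultimately have "sum hecke_weight ?S + 2 * sum hecke_weight ?R = - sum hecke_weight (f ` ?R \<inter> g ` ?R)"
    by simp
  with both show ?thesis by simp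
qed

lemma jtp_exp_2_1: "int (jtp_exp 2 1 k) = k * k"
  using jtp_exp_eq(1)[of 1 2 k] by (simp add: algebra_simps)

text \<open>The added 0 fits the premise of \<open>finite_le_of_abs_le\<close>.\<close>

lemma square_le_jtp_exp: "\<bar>k\<bar> \<le> int (jtp_exp 2 1 k) + 0" "\<bar>k\<bar> \<le> int (jtp_exp 6 2 k) + 0"
  using jtp_exp_eq(2)[of 1 2 k] jtp_exp_eq(2)[of 2 6 k] by auto

text \<open>Replacing f_1^2 by the Gauss series times f_2 leaves the Gauss series times 2 f_2^3,
  whose coefficient at m is the weight sum over \<open>two_squares\<close>.\<close>

lemma euler_f_product_hecke:
  "dcong 5 (section5 (2 * (euler_f 1 ^ 2 * euler_f 2 ^ 2))) (- 2 * (2 * (euler_f 1 ^ 2 * euler_f 2 ^ 2)))"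
proof -
  have "2 * (euler_f 1 ^ 2 * euler_f 2 ^ 2) =
      2 * (theta (\<lambda>k. (-1) ^ nat \<bar>k\<bar>) (jtp_exp 2 1) * euler_f 2 * euler_f 2 ^ 2)"
    by (simp only: gauss_square_theta)
  also have "\<dots> = theta (\<lambda>k. (-1) ^ nat \<bar>k\<bar>) (jtp_exp 2 1) * (2 * euler_f 2 ^ 3)"
    by (simp add: power2_eq_square power3_eq_cube mult_ac)
  also have "\<dots> = theta (\<lambda>k. (-1) ^ nat \<bar>k\<bar>) (jtp_exp 2 1) *
      theta (\<lambda>k. (-1) ^ nat \<bar>k\<bar> * (2 * k + 1)) (\<lambda>k. 2 * tri k)"
    by (subst jacobi_cube_theta) simp_all
  also have "\<dots> = theta hecke_weight (\<lambda>(k, l). jtp_exp 2 1 k + 2 * tri l)"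
    unfolding hecke_weight_def
  proof (rule theta_mult)
    show "finite {k. jtp_exp 2 1 k \<le> m}" for m
      by (rule finite_le_of_abs_le[OF square_le_jtp_exp(1)])
    have "\<bar>l\<bar> \<le> int (2 * tri l) + 1" for l
      using tri_ge[of l] by simp
    then show "finite {l. 2 * tri l \<le> m}" for m
      by (rule finite_le_of_abs_le)
  qed
  finally have eq: "2 * (euler_f 1 ^ 2 * euler_f 2 ^ 2) =
      theta hecke_weight (\<lambda>(k, l). jtp_exp 2 1 k + 2 * tri l)" .
  have "{z. (case z of (k, l) \<Rightarrow> jtp_exp 2 1 k + 2 * tri l) = m} = two_squares (int m)" for m
  proof -
    have "jtp_exp 2 1 k + 2 * tri l = m \<longleftrightarrow> k * k + l * (l + 1) = int m" for k l
      using jtp_exp_2_1[of k] tri_eq[of l] by linarith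
    then show ?thesis by (auto simp: two_squares_def)
  qed
  then have nth: "fps_nth (2 * (euler_f 1 ^ 2 * euler_f 2 ^ 2)) m = sum hecke_weight (two_squares (int m))" for m
    unfolding eq theta_nth by simp
  show ?thesis
    unfolding dcong_numeral_fps_iff
  proof
    fix M
    have shift: "int (5 * M + 1) = 5 * int M + 1" by simp
    have "5 dvd fps_nth (2 * (euler_f 1 ^ 2 * euler_f 2 ^ 2)) (5 * M + 1) +
        2 * fps_nth (2 * (euler_f 1 ^ 2 * euler_f 2 ^ 2)) M"
      using hecke_weight_sum_dcong[of "int M"] by (simp only: nth shift)
    then show "dcong 5 (fps_nth (section5 (2 * (euler_f 1 ^ 2 * euler_f 2 ^ 2))) M)
        (fps_nth (- 2 * (2 * (euler_f 1 ^ 2 * euler_f 2 ^ 2))) M)"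
      by (simp add: dcong_def numeral_fps_const)
  qed
qed

section \<open>The generating function modulo 5 and the conclusion\<close>

lemma dcong_unit_cancel:
  fixes u :: "'a::comm_ring_1"
  assumes "u * v = 1" "dcong d (u * a) (u * b)"
  shows "dcong d a b"
proof -
  have "dcong d (v * (u * a)) (v * (u * b))" by (intro dcong_mult dcong_refl assms)
  moreover have "v * (u * x) = x" for x
    using assms(1) by (metis mult.assoc mult.commute mult_1_left)
  ultimately show ?thesis by simp
qed

text \<open>With f_5 = f_1^5 modulo 5, the product 2 f_5 \<open>B\<close> becomes
  \<open>T\<close>(q^5) \<open>D\<close>. Taking the exponents 5M + 1 pulls f_5 out as f_1 and
  \<open>T\<close>(q^5) as \<open>T\<close>, and the Hecke relation gives -2 \<open>T\<close>
  \<open>D\<close>. A further factor f_2 makes \<open>T\<close> f_2 = f_1^2 available, after which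
  the unit f_1 f_2 cancels.\<close>

lemma section5_theta_a_gf:
  "dcong 5 (section5 (theta (\<lambda>k. (-1) ^ nat \<bar>k\<bar>) (\<lambda>k. 5 * jtp_exp 2 1 k) * a_gf))
    (- (2 * euler_f 1 ^ 3 * euler_f 2))"
proof -
  define T where "T = theta (\<lambda>k. (-1) ^ nat \<bar>k\<bar>) (jtp_exp 2 1)"
  define B where "B = (T oo fps_X ^ 5) * a_gf"
  define D where "D = 2 * (euler_f 1 ^ 2 * euler_f 2 ^ 2)"
  have "dcong 5 (2 * (euler_f 5 * B)) (2 * (euler_f 1 ^ 5 * B))"
    by (intro dcong_mult dcong_refl euler_f_1_power_5_dcong)
  also have "2 * (euler_f 1 ^ 5 * B) = (T oo fps_X ^ 5) * (2 * (euler_f 1 ^ 2 * (a_gf * euler_f 1 ^ 3)))"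
    by (simp add: B_def eval_nat_numeral mult_ac)
  also have "\<dots> = (T oo fps_X ^ 5) * D"
    by (simp only: a_gf_mult D_def)
  finally have "dcong 5 (section5 (2 * (euler_f 5 * B))) (section5 ((T oo fps_X ^ 5) * D))"
    by (rule section5_dcong)
  then have "dcong 5 (2 * (euler_f 1 * section5 B)) (T * section5 D)"
    by (simp only: section5_mult_numeral section5_compose_mult euler_f_compose[of 5, symmetric] one_le_numeral)
  also have "dcong 5 \<dots> (T * (- 2 * D))"
    unfolding D_def by (intro dcong_mult dcong_refl euler_f_product_hecke)
  finally have "dcong 5 (euler_f 2 * (2 * (euler_f 1 * section5 B))) (euler_f 2 * (T * (- 2 * D)))"
    by (rule dcong_mult[OF dcong_refl])
  also have "euler_f 2 * (T * (- 2 * D)) = - 4 * (T * euler_f 2) * (euler_f 1 ^ 2 * euler_f 2 ^ 2)"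
    by (simp add: D_def)
  also have "\<dots> = - 4 * (euler_f 1 ^ 4 * euler_f 2 ^ 2)"
    unfolding T_def gauss_square_theta by (simp add: eval_nat_numeral)
  finally have "dcong 5 (euler_f 1 * euler_f 2 * (2 * section5 B))
      (euler_f 1 * euler_f 2 * (- 4 * (euler_f 1 ^ 3 * euler_f 2)))"
    by (simp add: eval_nat_numeral mult_ac)
  moreover have "euler_f 1 * euler_f 2 * fps_right_inverse (euler_f 1 * euler_f 2) 1 = 1"
    by (rule fps_right_inverse) (simp add: euler_f_has_prod(2))
  ultimately have *: "dcong 5 (2 * section5 B) (- 4 * (euler_f 1 ^ 3 * euler_f 2))"
    by (rule dcong_unit_cancel[rotated])
  \<comment> \<open>Division by 2 is multiplication by its inverse 3 modulo 5, and 3 (-4) = -12 =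
    -2.\<close>
  have "dcong 5 (section5 B) (3 * (2 * section5 B))"
    unfolding dcong_def by (rule dvdI[of _ _ "- section5 B"]) simp
  also have "dcong 5 \<dots> (3 * (- 4 * (euler_f 1 ^ 3 * euler_f 2)))"
    by (intro dcong_mult dcong_refl *)
  also have "dcong 5 \<dots> (- (2 * euler_f 1 ^ 3 * euler_f 2))"
    unfolding dcong_def by (rule dvdI[of _ _ "- 2 * (euler_f 1 ^ 3 * euler_f 2)"]) simp
  finally show ?thesis
    by (simp add: B_def T_def theta_compose_X_power)
qed

text \<open>By the Jacobi and Euler series the exponents are l (l + 1)/2 + 3k^2 - k. Multiplying by
  24 and adding 5 = 3 + 2 completes both squares, with X = 6k - 1 and Y = 2l + 1.\<close>

lemma cube_product_nth_eq_0:
  assumes "\<And>X Y :: int. 2 * X\<^sup>2 + 3 * Y\<^sup>2 \<noteq> 24 * int M + 5"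
  shows "fps_nth (2 * euler_f 1 ^ 3 * euler_f 2) M = 0"
proof -
  let ?s = "\<lambda>(l :: int, k :: int). (-1) ^ nat \<bar>l\<bar> * (2 * l + 1) * (-1) ^ nat \<bar>k\<bar>"
  have "2 * euler_f 1 ^ 3 * euler_f 2 =
      theta (\<lambda>k. (-1) ^ nat \<bar>k\<bar> * (2 * k + 1)) tri * theta (\<lambda>k. (-1) ^ nat \<bar>k\<bar>) (jtp_exp 6 2)"
    using jacobi_cube_theta[of 1] by (simp add: pentagonal_theta)
  also have "\<dots> = theta ?s (\<lambda>(l, k). tri l + jtp_exp 6 2 k)"
    by (rule theta_mult; rule finite_le_of_abs_le) (rule tri_ge square_le_jtp_exp(2))+
  finally have eq: "2 * euler_f 1 ^ 3 * euler_f 2 = theta ?s (\<lambda>(l, k). tri l + jtp_exp 6 2 k)" .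
  have "tri l + jtp_exp 6 2 k \<noteq> M" for l k
  proof
    assume "tri l + jtp_exp 6 2 k = M"
    then have "24 * int M + 5 = 12 * (2 * int (tri l)) + 12 * (2 * int (jtp_exp 6 2 k)) + 5"
      by auto
    also have "\<dots> = 2 * (6 * k - 1)\<^sup>2 + 3 * (2 * l + 1)\<^sup>2"
      unfolding tri_eq jtp_exp_eq(1)[of 2 6 k, simplified] by (simp add: power2_eq_square algebra_simps)
    finally show False using assms by metis
  qed
  then have "{z. (case z of (l, k) \<Rightarrow> tri l + jtp_exp 6 2 k) = M} = {}" by auto
  then show ?thesis by (simp only: eq theta_nth sum.empty)
qed

text \<open>Both sides reduce to the finite sum over 5 k^2 <= m, on which the subtraction of natural
  numbers is exact.\<close>

lemma infsum_a_coeff_eq_nth: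
  "(\<Sum>\<^sub>\<infinity>k\<in>(UNIV :: int set). (- 1) ^ nat \<bar>k\<bar> * a_coeff (int m - 5 * k\<^sup>2)) =
    fps_nth (theta (\<lambda>k. (-1) ^ nat \<bar>k\<bar>) (\<lambda>k. 5 * jtp_exp 2 1 k) * a_gf) m"
proof -
  have le_iff: "5 * jtp_exp 2 1 k \<le> m \<longleftrightarrow> 5 * k\<^sup>2 \<le> int m" for k
  proof -
    have "int (5 * jtp_exp 2 1 k) = 5 * k\<^sup>2" using jtp_exp_2_1[of k] by (simp add: power2_eq_square)
    then show ?thesis by (metis of_nat_le_iff)
  qed
  have "fps_nth (theta (\<lambda>k. (-1) ^ nat \<bar>k\<bar>) (\<lambda>k. 5 * jtp_exp 2 1 k) * a_gf) m =
      (\<Sum>k | 5 * jtp_exp 2 1 k \<le> m. (-1) ^ nat \<bar>k\<bar> * fps_nth a_gf (m - 5 * jtp_exp 2 1 k))"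
    by (rule theta_mult_nth) (simp only: le_iff a_coeff_sum(1))
  also have "\<dots> = (\<Sum>k | 5 * k\<^sup>2 \<le> int m. (-1) ^ nat \<bar>k\<bar> * a_coeff (int m - 5 * k\<^sup>2))"
  proof (rule sum.cong)
    fix k assume "k \<in> {k. 5 * k\<^sup>2 \<le> int m}"
    then have "5 * k\<^sup>2 \<le> int m" by simp
    moreover have "nat (int m - 5 * k\<^sup>2) = m - 5 * jtp_exp 2 1 k"
      using jtp_exp_2_1[of k] by (simp add: power2_eq_square)
    ultimately show "(-1) ^ nat \<bar>k\<bar> * fps_nth a_gf (m - 5 * jtp_exp 2 1 k) =
        (-1) ^ nat \<bar>k\<bar> * a_coeff (int m - 5 * k\<^sup>2)"
      by (simp add: a_coeff_def)
  qed (simp only: le_iff)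
  finally show ?thesis by (simp only: a_coeff_sum(3))
qed

theorem theorem1p6:
  fixes p n r :: int
  assumes "prime p"
    and "[p = 13] (mod 24) \<or> [p = 17] (mod 24) \<or> [p = 19] (mod 24) \<or> [p = 23] (mod 24)"
    and "n \<ge> 0"
    and "r \<in> {1..p - 1}"
  shows "[(\<Sum>\<^sub>\<infinity>k\<in>(UNIV :: int set). (- 1) ^ nat \<bar>k\<bar> *
            a_coeff (5 * p\<^sup>2 * n + 5 * p * r + (25 * p\<^sup>2 - 1) div 24 - 5 * k\<^sup>2)) = 0] (mod 5)"
proof -
  have p24: "p mod 24 \<in> {13, 17, 19, 23}"
    using assms(2) by (auto simp: cong_def)
  have p0: "p > 0" using assms(1) by (simp add: prime_gt_0_int)
  have "p\<^sup>2 mod 24 = (p mod 24)\<^sup>2 mod 24" by (simp only: power_mod)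
  with p24 have "p\<^sup>2 mod 24 = 1" by auto
  then obtain t where t: "p\<^sup>2 = 24 * t + 1"
    by (metis mult_div_mod_eq)
  have "t \<ge> 0" using t zero_le_power2[of p] by linarith
  \<comment> \<open>Chosen so that the index in the theorem is 5M + 1, where t = (p^2 - 1)/24; the
    argument of \<open>nat\<close> is nonnegative.\<close>
  define M where "M = nat (p\<^sup>2 * n + p * r + 5 * t)"
  have M: "int M = p\<^sup>2 * n + p * r + 5 * t"
    using assms(3,4) p0 \<open>t \<ge> 0\<close> by (simp add: M_def)
  have index: "5 * p\<^sup>2 * n + 5 * p * r + (25 * p\<^sup>2 - 1) div 24 = int (5 * M + 1)"
  proof -
    have "25 * p\<^sup>2 - 1 = 24 * (25 * t + 1)" by (simp add: t)
    then have "(25 * p\<^sup>2 - 1) div 24 = 25 * t + 1" by simp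
    then show ?thesis by (simp add: M)
  qed
  have "2 * X\<^sup>2 + 3 * Y\<^sup>2 \<noteq> 24 * int M + 5" for X Y :: int
  proof
    assume "2 * X\<^sup>2 + 3 * Y\<^sup>2 = 24 * int M + 5"
    \<comment> \<open>Uses 120 t + 5 = 5 (24 t + 1) = 5 p^2.\<close>
    also have "\<dots> = 24 * (p * r) + p\<^sup>2 * (24 * n + 5)"
      by (simp add: M t algebra_simps)
    finally have eq: "2 * X\<^sup>2 + 3 * Y\<^sup>2 = 24 * (p * r) + p\<^sup>2 * (24 * n + 5)" .
    then have "2 * X\<^sup>2 + 3 * Y\<^sup>2 = p * (24 * r + p * (24 * n + 5))"
      by (simp add: power2_eq_square algebra_simps)
    then have "p dvd 2 * X\<^sup>2 + 3 * Y\<^sup>2" by simp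
    then have "p dvd X" "p dvd Y" using dvd_form_imp_dvd[OF assms(1) p24] by blast+
    \<comment> \<open>Here the right side of \<open>eq\<close> must be divisible by p^2, which its
      term 24 p r prevents, as p divides neither r nor 24.\<close>
    then have "p\<^sup>2 dvd 2 * X\<^sup>2 + 3 * Y\<^sup>2" by (simp add: dvd_power_same)
    then have "p\<^sup>2 dvd 24 * (p * r)" by (simp add: eq dvd_add_left_iff)
    then have "p * p dvd p * (24 * r)" by (simp add: power2_eq_square mult_ac)
    then have "p dvd 24 * r" using p0 by simp
    moreover have "\<not> p dvd r" using assms(4) zdvd_not_zless[of r p] by auto
    ultimately have "p dvd 24" using assms(1) by (simp add: prime_dvd_mult_iff)
    then have "p \<le> 24" by (simp add: zdvd_imp_le)
    then have "p = 24 \<or> p mod 24 = p" using p0 by (cases "p = 24") simp_all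
    with p24 have "p \<in> {13, 17, 19, 23}" by auto
    with \<open>p dvd 24\<close> show False by auto
  qed
  then have "fps_nth (2 * euler_f 1 ^ 3 * euler_f 2) M = 0"
    by (rule cube_product_nth_eq_0)
  moreover have "dcong 5 (fps_nth (section5 (theta (\<lambda>k. (-1) ^ nat \<bar>k\<bar>) (\<lambda>k. 5 * jtp_exp 2 1 k) * a_gf)) M)
      (fps_nth (- (2 * euler_f 1 ^ 3 * euler_f 2)) M)"
    using section5_theta_a_gf unfolding dcong_numeral_fps_iff ..
  ultimately have "5 dvd fps_nth (theta (\<lambda>k. (-1) ^ nat \<bar>k\<bar>) (\<lambda>k. 5 * jtp_exp 2 1 k) * a_gf) (5 * M + 1)"
    unfolding dcong_def fps_neg_nth section5_nth by simp
  then show ?thesis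
    unfolding index infsum_a_coeff_eq_nth cong_0_iff .
qed

end
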